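(* Let $a\in L^1(I)$ and $\lambda\in\mathbb{R}$. If the operator $L[\lambda]$ is nonresonant in $X_D$ and $r_2'[\lambda](1)\neq0$, then for all $(t,s)\in I\times I$ $$G_{M_2}[\lambda](t,s)=G_D[\lambda](t,s)-\frac{r_2[\lambda](t)}{r_2'[\lambda](1)}\,\frac{\partial}{\partial t}G_D[\lambda](1,s)$$ $$=G_D[\lambda](t,s)-\frac{\frac{\partial}{\partial s}G_D[\lambda](t,1)}{\frac{\partial^2}{\partial s\,\partial t}G_D[\lambda](1,1)}\,\frac{\partial}{\partial t}G_D[\lambda](1,s).$$
   Context: $I=[0,1]$, $a\in L^1(I)$ is real-valued, $\lambda\in\mathbb{R}$, and $L[\lambda]u(t)=u''(t)+(a(t)+\lambda)u(t)$. $W^{2,1}(I)=\{u\in C(I):u'\in AC(I)\}$, where $AC(I)$ is the set of absolutely continuous functions on $I$. $X_D=\{u\in W^{2,1}(I):u(0)=u(1)=0\}$ (Dirichlet) and $X_{M_2}=\{u\in W^{2,1}(I):u(0)=u'(1)=0\}$ (Mixed 2). $L[\lambda]$ is nonresonant in $X$ if $u=0$ is the only $u\in X$ with $L[\lambda]u=0$ a.e. on $I$. In that case, for every $\sigma\in L^1(I)$ the problem $L[\lambda]u=\sigma$ a.e. on $I$, $u\in X$, has a unique solution, given by $u(t)=\int_0^1G(t,s)\sigma(s)\,ds$, where the continuous function $G:I\times I\to\mathbb{R}$ is the Green's function; it is denoted $G_D[\lambda]$ for $X=X_D$ and $G_{M_2}[\lambda]$ for $X=X_{M_2}$ (the latter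 exists under the hypotheses of the claim). $r_2[\lambda]$ is the unique solution of $L[\lambda]u=0$ a.e. on $I$, $u(0)=0$, $u(1)=1$; $r_2'[\lambda]$ is its derivative in $t$. Convention: $\frac{\partial}{\partial s}G(t,1)$ is the (one-sided) derivative in the second variable for $t\in(0,1)$, extended by continuity to $t\in\{0,1\}$; $\frac{\partial}{\partial t}G(1,s)$ is the one-sided derivative in the first variable at $t=1$ for $s\in(0,1)$, extended by continuity to $s\in\{0,1\}$; $\frac{\partial^2}{\partial s\,\partial t}G_D[\lambda](1,1)$ is the derivative at $t=1$ of the function $t\mapsto\frac{\partial}{\partial s}G_D[\lambda](t,1)$. *)

theory Defs
  imports "HOL-Analysis.Analysis"
begin

text \<open>
  Functions on \<open>I = [0,1]\<close> are total functions on the reals of which only the values on \<open>{0..1}\<close>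
  matter: every derivative below is taken within \<open>{0..1}\<close> (so it is one-sided at the end points),
  and "almost everywhere" and integrability refer to \<open>lebesgue_on {0..1}\<close>.
\<close>

definition abs_continuous_on :: "real set \<Rightarrow> (real \<Rightarrow> real) \<Rightarrow> bool" where
  "abs_continuous_on S f \<longleftrightarrow>
     (\<forall>\<epsilon>>0. \<exists>\<delta>>0. \<forall>(n::nat) (x::nat \<Rightarrow> real) (y::nat \<Rightarrow> real).
        (\<forall>i<n. x i \<le> y i \<and> {x i..y i} \<subseteq> S) \<and>
        disjoint_family_on (\<lambda>i. {x i<..<y i}) {..<n} \<and>
        (\<Sum>i<n. y i - x i) < \<delta>
        \<longrightarrow> (\<Sum>i<n. \<bar>f (y i) - f (x i)\<bar>) < \<epsilon>)"

definition D :: "(real \<Rightarrow> real) \<Rightarrow> real \<Rightarrow> real" where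
  "D u t = vector_derivative u (at t within {0..1})"

definition W21 :: "(real \<Rightarrow> real) set" where
  "W21 = {u. continuous_on {0..1} u \<and>
             (\<forall>t\<in>{0..1}. u differentiable (at t within {0..1})) \<and>
             abs_continuous_on {0..1} (D u)}"

definition X_D :: "(real \<Rightarrow> real) set" where
  "X_D = {u \<in> W21. u 0 = 0 \<and> u 1 = 0}"

definition X_M2 :: "(real \<Rightarrow> real) set" where
  "X_M2 = {u \<in> W21. u 0 = 0 \<and> D u 1 = 0}"

text \<open>\<open>L_eq a lam u \<sigma>\<close> states that \<open>u'' + (a + lam) u = \<sigma>\<close> almost everywhere on \<open>[0,1]\<close>; the
  second derivative \<open>w\<close> need only exist almost everywhere.\<close>

definition L_eq :: "(real \<Rightarrow> real) \<Rightarrow> real \<Rightarrow> (real \<Rightarrow> real) \<Rightarrow> (real \<Rightarrow> real) \<Rightarrow> bool" where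
  "L_eq a lam u \<sigma> \<longleftrightarrow>
     (AE t in lebesgue_on {0..1}.
        \<exists>w. (D u has_real_derivative w) (at t within {0..1}) \<and> w + (a t + lam) * u t = \<sigma> t)"

definition nonresonant :: "(real \<Rightarrow> real) set \<Rightarrow> (real \<Rightarrow> real) \<Rightarrow> real \<Rightarrow> bool" where
  "nonresonant X a lam \<longleftrightarrow>
     (\<forall>u\<in>X. L_eq a lam u (\<lambda>_. 0) \<longrightarrow> (\<forall>t\<in>{0..1}. u t = 0))"

definition is_green :: "(real \<Rightarrow> real) set \<Rightarrow> (real \<Rightarrow> real) \<Rightarrow> real \<Rightarrow> (real \<times> real \<Rightarrow> real) \<Rightarrow> bool" where
  "is_green X a lam G \<longleftrightarrow>
     continuous_on ({0..1} \<times> {0..1}) G \<and>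
     (\<forall>\<sigma>. integrable (lebesgue_on {0..1}) \<sigma> \<longrightarrow>
        (let v = (\<lambda>t. integral\<^sup>L (lebesgue_on {0..1}) (\<lambda>s. G (t, s) * \<sigma> s)) in
           v \<in> X \<and> L_eq a lam v \<sigma> \<and>
           (\<forall>u\<in>X. L_eq a lam u \<sigma> \<longrightarrow> (\<forall>t\<in>{0..1}. u t = v t))))"

text \<open>In \<open>green\<close> and \<open>r2\<close>, the set \<open>extensional\<close> fixes the irrelevant values outside \<open>[0,1] \<times> [0,1]\<close>
  and \<open>[0,1]\<close>, so that the described object is unique.\<close>

definition green :: "(real \<Rightarrow> real) set \<Rightarrow> (real \<Rightarrow> real) \<Rightarrow> real \<Rightarrow> real \<times> real \<Rightarrow> real" where
  "green X a lam = (THE G. is_green X a lam G \<and> G \<in> extensional ({0..1} \<times> {0..1}))"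

definition r2 :: "(real \<Rightarrow> real) \<Rightarrow> real \<Rightarrow> real \<Rightarrow> real" where
  "r2 a lam = (THE u. u \<in> W21 \<and> L_eq a lam u (\<lambda>_. 0) \<and> u 0 = 0 \<and> u 1 = 1 \<and>
                      u \<in> extensional {0..1})"

text \<open>Continuous extension to \<open>[0,1]\<close> of a function given on the open interval.\<close>

definition ext01 :: "(real \<Rightarrow> real) \<Rightarrow> real \<Rightarrow> real" where
  "ext01 f t = (if t \<in> {0<..<1} then f t else Lim (at t within {0<..<1}) f)"

definition ds_at_1 :: "(real \<times> real \<Rightarrow> real) \<Rightarrow> real \<Rightarrow> real" where
  "ds_at_1 G = ext01 (\<lambda>t. D (\<lambda>s. G (t, s)) 1)"

definition dt_at_1 :: "(real \<times> real \<Rightarrow> real) \<Rightarrow> real \<Rightarrow> real" where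
  "dt_at_1 G = ext01 (\<lambda>s. D (\<lambda>t. G (t, s)) 1)"

definition dsdt_at_11 :: "(real \<times> real \<Rightarrow> real) \<Rightarrow> real" where
  "dsdt_at_11 G = D (ds_at_1 G) 1"

end

theory Submission
  imports Defs
begin

text \<open>
  Everything is explicit in two solutions of the homogeneous equation: \<open>\<rho>\<close> with \<open>\<rho> 0 = 0\<close>, \<open>\<rho> 1 = 1\<close>, and
  \<open>\<eta>\<close> with \<open>\<eta> 1 = 0\<close>, \<open>\<eta>' 1 = 1\<close>. They exist because Dirichlet nonresonance prevents a nonzero solution
  that vanishes at \<open>0\<close> from vanishing at \<open>1\<close> (\<open>fundamental_system_exists\<close>). Their Wronskian
  is \<open>1\<close> at \<open>t = 1\<close>, hence everywhere, so the Dirichlet Green's function is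
  \<open>\<rho> (min t s) * \<eta> (max t s)\<close> (\<open>green_kernel_representation\<close>). Since \<open>\<eta>' 1 = 1\<close>, its derivative in
  either variable at the end point \<open>1\<close> is \<open>\<rho>\<close> of the other variable, and \<open>\<rho>\<close> is \<open>r2\<close>
  (\<open>D_green_kernel_at_1\<close>, \<open>r2_eq\<close>). Both formulas of the theorem thus say that the Green's function of
  the mixed problem is the Dirichlet one minus \<open>\<rho> t * \<rho> s / \<rho>' 1\<close>.

  To see this, let \<open>v\<close> be the Dirichlet solution for the right-hand side \<open>\<sigma>\<close>. Then
  \<open>v - (v' 1 / \<rho>' 1) \<rho>\<close> solves the mixed problem, and the Lagrange identity for \<open>\<rho>\<close> and \<open>v\<close> on \<open>[0, 1]\<close>
  shows that \<open>v' 1\<close> is the integral of \<open>\<rho> \<sigma>\<close>. Uniqueness for the mixed problem holds since a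
  homogeneous solution with \<open>u 0 = 0\<close> equals \<open>u 1\<close> times \<open>\<rho>\<close>, and \<open>\<rho>' 1 \<noteq> 0\<close>.

  Because the potential is only integrable, solutions are constructed from the integrated first-order
  system (\<open>integral_solution\<close>) by a Picard series, and the Lagrange identity is derived from Fubini's
  theorem (\<open>mult_indefinite_integrals\<close>) instead of the product rule. Lebesgue's differentiation theorem
  and the absolute continuity of the integral then show that integral solutions lie in \<open>W21\<close> and solve the
  equation almost everywhere. An arbitrary solution in \<open>W21\<close> of the almost-everywhere equation is compared
  with a constructed one through their difference, to which nonresonance applies.
\<close>

section \<open>Indefinite integrals of integrable functions\<close>

lemma integrable_on_subinterval_real:
  fixes f :: "real \<Rightarrow> real"
  assumes "integrable (lebesgue_on {a..b}) f" "{x..y} \<subseteq> {a..b}"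
  shows "f integrable_on {x..y}"
  using integrable_subinterval[OF assms] by (simp add: integrable_on_lebesgue_on)

lemma integral_diff_subinterval:
  fixes f :: "real \<Rightarrow> real"
  assumes "integrable (lebesgue_on {a..b}) f" "a \<le> x" "x \<le> y" "y \<le> b"
  shows "integral {a..y} f - integral {a..x} f = integral {x..y} f"
  using Henstock_Kurzweil_Integration.integral_combine[of a x y f] integrable_on_subinterval_real[OF assms(1), of a y] assms by auto

lemma continuous_on_indefinite_integral:
  fixes f :: "real \<Rightarrow> real"
  assumes "integrable (lebesgue_on {a..b}) f"
  shows "continuous_on {a..b} (\<lambda>t. integral {a..t} f)"
  using indefinite_integral_continuous_1 integrable_on_lebesgue_on[OF assms] by simp

lemma integrable_mult_continuous:
  fixes f g :: "real \<Rightarrow> real"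
  assumes f: "integrable (lebesgue_on {a..b}) f" and g: "continuous_on {a..b} g"
  shows "integrable (lebesgue_on {a..b}) (\<lambda>t. f t * g t)"
proof -
  have "(\<lambda>t. g t * f t) absolutely_integrable_on {a..b}"
  proof (rule absolutely_integrable_bounded_measurable_product_real)
    show "g \<in> borel_measurable (lebesgue_on {a..b})"
      by (rule continuous_imp_measurable_on_sets_lebesgue[OF g]) auto
    show "bounded (g ` {a..b})"
      using compact_continuous_image[OF g] compact_imp_bounded by blast
    show "f absolutely_integrable_on {a..b}"
      using f by (simp add: integrable_restrict_space set_integrable_def)
  qed auto
  then show ?thesis
    using absolutely_integrable_imp_integrable by (fastforce simp: mult.commute)
qed

lemma integrable_indicator_mult:
  fixes f :: "real \<Rightarrow> real"
  assumes f: "integrable (lebesgue_on S) f" and A: "A \<in> sets borel"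
  shows "integrable (lebesgue_on S) (\<lambda>t. indicator A t * f t)"
proof (rule Bochner_Integration.integrable_bound[OF f])
  have "indicator A \<in> borel_measurable (lebesgue_on S)"
    using A by (intro measurable_restrict_space1 borel_measurable_indicator) auto
  then show "(\<lambda>t. indicator A t * f t) \<in> borel_measurable (lebesgue_on S)"
    using f by (intro borel_measurable_times) auto
qed (auto simp: indicator_def)

text \<open>
  Lebesgue's differentiation theorem on the line. The averages over shrinking cubes that have
  \<open>x\<close> as their lower corner converge to \<open>f x\<close> almost everywhere
  (\<open>integrable_ccontinuous_explicit\<close>); on the line this is the derivative from the right. The
  derivative from the left is the same fact for the reflected function \<open>x \<mapsto> f (- x)\<close>.
\<close>
lemma AE_has_real_derivative_indefinite_integral:
  fixes f :: "real \<Rightarrow> real"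
  assumes f: "integrable (lebesgue_on {a..b}) f"
  shows "AE t in lebesgue_on {a..b}.
           ((\<lambda>x. integral {a..x} f) has_real_derivative f t) (at t within {a..b})"
proof -
  define g where "g x = (if x \<in> {a..b} then f x else 0)" for x
  have gi: "g integrable_on UNIV"
    unfolding g_def using integrable_on_lebesgue_on[OF f] by (subst integrable_restrict_UNIV) auto
  have g: "g integrable_on cbox x y" for x y
    using gi integrable_on_subcbox by blast
  have g': "(\<lambda>x. g (- x)) integrable_on cbox x y" for x y
    using g[of "-y" "-x"] integrable_reflect[of g "-x" "-y"] by simp
  obtain N where N: "negligible N"
    "\<And>x e. \<lbrakk>x \<notin> N; 0 < e\<rbrakk> \<Longrightarrow> \<exists>d>0. \<forall>h. 0 < h \<and> h < d \<longrightarrow>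
        norm (integral (cbox x (x + h *\<^sub>R One)) g /\<^sub>R h ^ DIM(real) - g x) < e"
    using integrable_ccontinuous_explicit[of g] g by blast
  obtain N' where N': "negligible N'"
    "\<And>x e. \<lbrakk>x \<notin> N'; 0 < e\<rbrakk> \<Longrightarrow> \<exists>d>0. \<forall>h. 0 < h \<and> h < d \<longrightarrow>
        norm (integral (cbox x (x + h *\<^sub>R One)) (\<lambda>x. g (- x)) /\<^sub>R h ^ DIM(real) - g (- x)) < e"
    using integrable_ccontinuous_explicit[of "\<lambda>x. g (- x)"] g' by blast
  have neg: "negligible (uminus ` N')"
    using N'(1) by (intro negligible_differentiable_image_negligible) (auto simp: differentiable_on_def)
  have ig: "integral {x..y} g = integral {x..y} f" if "{x..y} \<subseteq> {a..b}" for x y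
    using that by (intro integral_cong) (auto simp: g_def)
  have main: "((\<lambda>x. integral {a..x} f) has_real_derivative f t) (at t within {a..b})"
    if t: "t \<in> {a..b}" "t \<notin> N" "t \<notin> uminus ` N'" for t
    unfolding has_field_derivative_iff Lim_within
  proof (intro allI impI)
    fix e :: real assume e: "e > 0"
    have "- t \<notin> N'" using t(3) by (metis imageI minus_minus)
    obtain d where d: "d > 0" "\<And>h. 0 < h \<and> h < d \<Longrightarrow> \<bar>integral {t..t + h} g / h - g t\<bar> < e"
      using N(2)[OF t(2) e] by (auto simp: divide_inverse mult.commute)
    obtain d' where d': "d' > 0" "\<And>h. 0 < h \<and> h < d' \<Longrightarrow>
          \<bar>integral {- t..- t + h} (\<lambda>x. g (- x)) / h - g t\<bar> < e"
      using N'(2)[OF \<open>- t \<notin> N'\<close> e] by (auto simp: divide_inverse mult.commute)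
    show "\<exists>d>0. \<forall>x\<in>{a..b}. 0 < dist x t \<and> dist x t < d \<longrightarrow>
         dist ((integral {a..x} f - integral {a..t} f) / (x - t)) (f t) < e"
    proof (intro exI[of _ "min d d'"] conjI ballI impI)
      fix x assume x: "x \<in> {a..b}" and xt: "0 < dist x t \<and> dist x t < min d d'"
      show "dist ((integral {a..x} f - integral {a..t} f) / (x - t)) (f t) < e"
      proof (cases "x > t")
        case True
        then show ?thesis
          using d(2)[of "x - t"] xt t(1) x integral_diff_subinterval[OF f, of t x]
          by (simp add: dist_real_def ig g_def)
      next
        case False
        then have lt: "x < t" using xt by (cases "x = t") auto
        have "integral {- t..- x} (\<lambda>x. g (- x)) = integral {x..t} f"
          using integral_reflect_real[of t x g] ig[of x t] t(1) x by simp
        moreover have "(integral {a..x} f - integral {a..t} f) / (x - t) = integral {x..t} f / (t - x)"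
          using integral_diff_subinterval[OF f, of x t] lt t(1) x by (simp add: field_simps)
        ultimately show ?thesis
          using d'(2)[of "t - x"] lt xt t(1) by (simp add: dist_real_def g_def)
      qed
    qed (use d d' in auto)
  qed
  have "N \<union> uminus ` N' \<in> null_sets lebesgue"
    using negligible_Un[OF N(1) neg] by (simp add: negligible_iff_null_sets)
  then have "AE t in lebesgue. t \<notin> N \<union> uminus ` N'"
    by (rule AE_not_in)
  then have "AE t in lebesgue. t \<in> {a..b} \<longrightarrow>
      ((\<lambda>x. integral {a..x} f) has_real_derivative f t) (at t within {a..b})"
    by eventually_elim (use main in auto)
  then show ?thesis by (subst AE_restrict_space_iff) auto
qed

text \<open>
  Truncation: \<open>\<bar>f\<bar> \<le> n + max 0 (\<bar>f\<bar> - n)\<close>, where the excess has integral below \<open>\<epsilon> / 2\<close> once \<open>n\<close> is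
  large. Over disjoint intervals of total length \<open>\<ell>\<close> the increments therefore add up to at most
  \<open>n * \<ell> + \<epsilon> / 2\<close>.
\<close>
lemma abs_continuous_on_indefinite_integral:
  fixes f :: "real \<Rightarrow> real"
  assumes f: "integrable (lebesgue_on {a..b}) f"
  shows "abs_continuous_on {a..b} (\<lambda>t. c + integral {a..t} f)"
  unfolding abs_continuous_on_def
proof (intro allI impI)
  fix \<epsilon> :: real assume \<epsilon>: "\<epsilon> > 0"
  let ?M = "lebesgue_on {a..b}"
  define h where "h = (\<lambda>(n::nat) t. max 0 (\<bar>f t\<bar> - real n))"
  have [measurable]: "f \<in> borel_measurable ?M" using f by auto
  have hm[measurable]: "h n \<in> borel_measurable ?M" for n unfolding h_def by measurable
  have hi: "integrable ?M (h n)" for n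
    by (rule Bochner_Integration.integrable_bound[OF integrable_abs[OF f]]) (auto simp: h_def)
  have "(\<lambda>n. integral\<^sup>L ?M (h n)) \<longlonglongrightarrow> integral\<^sup>L ?M (\<lambda>t. 0)"
  proof (rule integral_dominated_convergence[OF _ _ integrable_abs[OF f]])
    have "(\<lambda>n. h n t) \<longlonglongrightarrow> 0" for t
    proof (rule tendsto_eventually)
      obtain m :: nat where "\<bar>f t\<bar> \<le> real m" using real_arch_simple by blast
      then show "\<forall>\<^sub>F n in sequentially. h n t = 0"
        unfolding eventually_sequentially h_def by (intro exI[of _ m]) auto
    qed
    then show "AE t in ?M. (\<lambda>n. h n t) \<longlonglongrightarrow> 0" by simp
  qed (auto simp: h_def)
  then have "eventually (\<lambda>n. integral\<^sup>L ?M (h n) < \<epsilon> / 2) sequentially"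
    using \<epsilon> by (intro order_tendstoD(2)) auto
  then obtain n where n: "integral\<^sup>L ?M (h n) < \<epsilon> / 2"
    by (auto simp: eventually_sequentially)
  have hn: "0 \<le> h n t" for t by (simp add: h_def)
  have fh: "\<bar>f t\<bar> \<le> real n + h n t" for t by (simp add: h_def)
  show "\<exists>\<delta>>0. \<forall>(k::nat) (x::nat \<Rightarrow> real) y.
        (\<forall>i<k. x i \<le> y i \<and> {x i..y i} \<subseteq> {a..b}) \<and>
        disjoint_family_on (\<lambda>i. {x i<..<y i}) {..<k} \<and> (\<Sum>i<k. y i - x i) < \<delta> \<longrightarrow>
        (\<Sum>i<k. \<bar>(c + integral {a..y i} f) - (c + integral {a..x i} f)\<bar>) < \<epsilon>"
  proof (intro exI[of _ "\<epsilon> / (2 * (real n + 1))"] conjI allI impI)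
    show "0 < \<epsilon> / (2 * (real n + 1))" using \<epsilon> by simp
    fix k :: nat and x y :: "nat \<Rightarrow> real"
    assume "(\<forall>i<k. x i \<le> y i \<and> {x i..y i} \<subseteq> {a..b}) \<and>
        disjoint_family_on (\<lambda>i. {x i<..<y i}) {..<k} \<and>
        (\<Sum>i<k. y i - x i) < \<epsilon> / (2 * (real n + 1))"
    then have xy: "\<And>i. i < k \<Longrightarrow> x i \<le> y i" "\<And>i. i < k \<Longrightarrow> {x i..y i} \<subseteq> {a..b}"
      and disj: "disjoint_family_on (\<lambda>i. {x i<..<y i}) {..<k}"
      and small: "(\<Sum>i<k. y i - x i) < \<epsilon> / (2 * (real n + 1))" by auto
    have ind: "integrable ?M (\<lambda>t. indicator {x i<..<y i} t * h n t)" for i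
      by (intro integrable_indicator_mult hi) auto
    have bound: "\<bar>(c + integral {a..y i} f) - (c + integral {a..x i} f)\<bar>
        \<le> real n * (y i - x i) + integral\<^sup>L ?M (\<lambda>t. indicator {x i<..<y i} t * h n t)" if i: "i < k" for i
    proof -
      have sub: "{x i..y i} \<subseteq> {a..b}" "a \<le> x i" "y i \<le> b" "x i \<le> y i" using xy[OF i] by auto
      have "\<bar>(c + integral {a..y i} f) - (c + integral {a..x i} f)\<bar> = \<bar>integral {x i..y i} f\<bar>"
        using integral_diff_subinterval[OF f, of "x i" "y i"] sub by simp
      also have "\<dots> \<le> integral {x i..y i} (\<lambda>t. real n + h n t)"
        using integral_norm_bound_integral[of f "{x i..y i}" "\<lambda>t. real n + h n t"]
          integrable_on_subinterval_real[OF f sub(1)] fh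
          Henstock_Kurzweil_Integration.integrable_add[OF integrable_const_ivl
            integrable_on_subinterval_real[OF hi sub(1)], of "real n" n]
        by auto
      also have "\<dots> = real n * (y i - x i) + integral {x i..y i} (h n)"
        using sub integrable_on_subinterval_real[OF hi sub(1)] by (subst integral_add) auto
      also have "integral {x i..y i} (h n) = integral {x i<..<y i} (h n)"
        by (simp add: integral_open_interval_real)
      also have "\<dots> = integral {a..b} (\<lambda>t. indicator {x i<..<y i} t * h n t)"
      proof -
        have "integral {x i<..<y i} (h n) = integral ({x i<..<y i} \<inter> {a..b}) (h n)"
          using sub by (intro arg_cong2[of _ _ _ _ integral]) auto
        also have "\<dots> = integral {a..b} (\<lambda>t. if t \<in> {x i<..<y i} then h n t else 0)"
          by (simp only: integral_restrict_Int Int_commute)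
        also have "\<dots> = integral {a..b} (\<lambda>t. indicator {x i<..<y i} t * h n t)"
          by (intro integral_cong) (auto simp: indicator_def)
        finally show ?thesis .
      qed
      also have "\<dots> = integral\<^sup>L ?M (\<lambda>t. indicator {x i<..<y i} t * h n t)"
        using ind by (simp add: lebesgue_integral_eq_integral)
      finally show ?thesis by simp
    qed
    have "(\<Sum>i<k. integral\<^sup>L ?M (\<lambda>t. indicator {x i<..<y i} t * h n t))
        = integral\<^sup>L ?M (\<lambda>t. \<Sum>i<k. indicator {x i<..<y i} t * h n t)"
      using ind by (intro Bochner_Integration.integral_sum[symmetric]) auto
    also have "\<dots> \<le> integral\<^sup>L ?M (h n)"
    proof (rule integral_mono)
      fix t
      have "(\<Sum>i<k. indicator {x i<..<y i} t * h n t) = indicator (\<Union>i<k. {x i<..<y i}) t * h n t"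
        unfolding indicator_UN_disjoint[OF finite_lessThan disj] sum_distrib_right ..
      also have "\<dots> \<le> h n t" by (auto simp: indicator_def hn)
      finally show "(\<Sum>i<k. indicator {x i<..<y i} t * h n t) \<le> h n t" .
    qed (intro Bochner_Integration.integrable_sum ind hi)+
    finally have A: "(\<Sum>i<k. integral\<^sup>L ?M (\<lambda>t. indicator {x i<..<y i} t * h n t)) < \<epsilon> / 2"
      using n by simp
    have S0: "0 \<le> (\<Sum>i<k. y i - x i)" using xy(1) by (intro sum_nonneg) auto
    have "real n * (\<Sum>i<k. y i - x i) \<le> (real n + 1) * (\<Sum>i<k. y i - x i)"
      using S0 by (simp add: mult_right_mono)
    also have "\<dots> < \<epsilon> / 2" using small by (simp add: field_simps)
    finally have B: "real n * (\<Sum>i<k. y i - x i) < \<epsilon> / 2" .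
    have "(\<Sum>i<k. \<bar>(c + integral {a..y i} f) - (c + integral {a..x i} f)\<bar>)
        \<le> (\<Sum>i<k. real n * (y i - x i) + integral\<^sup>L ?M (\<lambda>t. indicator {x i<..<y i} t * h n t))"
      by (intro sum_mono bound) auto
    also have "\<dots> < \<epsilon>" using A B by (simp add: sum.distrib sum_distrib_left)
    finally show "(\<Sum>i<k. \<bar>(c + integral {a..y i} f) - (c + integral {a..x i} f)\<bar>) < \<epsilon>" .
  qed
qed

lemma lebesgue_integral_indicator_mult:
  fixes f :: "real \<Rightarrow> real"
  assumes f: "integrable (lebesgue_on {a..b}) f" and x: "x \<in> {a..b}"
  shows "integral\<^sup>L (lebesgue_on {a..b}) (\<lambda>t. indicator {x<..} t * f t) = integral {x..b} f"
    and "integral\<^sup>L (lebesgue_on {a..b}) (\<lambda>t. indicator {..<x} t * f t) = integral {a..x} f"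
proof -
  have *: "integral\<^sup>L (lebesgue_on {a..b}) (\<lambda>t. indicator A t * f t) = integral ({a..b} \<inter> A) f"
    if "A \<in> sets borel" for A
  proof -
    have "integral\<^sup>L (lebesgue_on {a..b}) (\<lambda>t. indicator A t * f t)
        = integral {a..b} (\<lambda>t. indicator A t * f t)"
      using integrable_indicator_mult[OF f that] by (simp add: lebesgue_integral_eq_integral)
    also have "\<dots> = integral {a..b} (\<lambda>t. if t \<in> A then f t else 0)"
      by (intro integral_cong) (auto simp: indicator_def)
    finally show ?thesis by (simp only: integral_restrict_Int Int_commute)
  qed
  have "integral ({a..b} \<inter> {x<..}) f = integral {x..b} f"
    by (rule integral_spike_set; rule negligible_subset[of "{x}"]) (use x in auto)
  then show "integral\<^sup>L (lebesgue_on {a..b}) (\<lambda>t. indicator {x<..} t * f t) = integral {x..b} f"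
    by (subst *) auto
  have "integral ({a..b} \<inter> {..<x}) f = integral {a..x} f"
    by (rule integral_spike_set; rule negligible_subset[of "{x}"]) (use x in auto)
  then show "integral\<^sup>L (lebesgue_on {a..b}) (\<lambda>t. indicator {..<x} t * f t) = integral {a..x} f"
    by (subst *) auto
qed

text \<open>
  Integration by parts for two functions that are merely integrable, so that no derivative is at hand.
  The product of the integrals is the integral of \<open>f x * g y\<close> over a square; each of the two terms on
  the right is the integral over one of the triangles \<open>y \<le> x\<close> and \<open>x < y\<close>, and Fubini's theorem exchanges
  the order of integration in the second.
\<close>
lemma mult_indefinite_integrals:
  fixes f g :: "real \<Rightarrow> real"
  assumes f: "integrable (lebesgue_on {a..b}) f" and g: "integrable (lebesgue_on {a..b}) g"
  shows "integral {a..b} f * integral {a..b} g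
       = integral {a..b} (\<lambda>t. f t * integral {a..t} g + integral {a..t} f * g t)"
proof -
  let ?M = "lebesgue_on {a..b}"
  interpret M: finite_measure ?M by (rule finite_measure_lebesgue_on) auto
  interpret P: pair_sigma_finite ?M ?M ..
  define H where "H x y = f x * (indicator {x<..} y * g y)" for x y :: real
  have H': "H x y = g y * (indicator {..<y} x * f x)" for x y
    by (simp add: H_def indicator_def)
  have id: "(\<lambda>x. x) \<in> borel_measurable ?M"
    by (intro measurable_restrict_space1 measurable_completion) auto
  have Hm: "case_prod H \<in> borel_measurable (?M \<Otimes>\<^sub>M ?M)"
  proof -
    have [measurable]: "(\<lambda>z. f (fst z)) \<in> borel_measurable (?M \<Otimes>\<^sub>M ?M)"
      "(\<lambda>z. g (snd z)) \<in> borel_measurable (?M \<Otimes>\<^sub>M ?M)"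
      "(\<lambda>z. fst z) \<in> borel_measurable (?M \<Otimes>\<^sub>M ?M)" "(\<lambda>z. snd z) \<in> borel_measurable (?M \<Otimes>\<^sub>M ?M)"
      using f g measurable_compose[OF measurable_fst, of f ?M borel ?M]
        measurable_compose[OF measurable_snd, of g ?M borel ?M]
        measurable_compose[OF measurable_fst id] measurable_compose[OF measurable_snd id] by auto
    have "case_prod H = (\<lambda>z. f (fst z) * (if fst z < snd z then g (snd z) else 0))"
      by (auto simp: H_def indicator_def)
    moreover have "(\<lambda>z. f (fst z) * (if fst z < snd z then g (snd z) else 0)) \<in> borel_measurable (?M \<Otimes>\<^sub>M ?M)"
      by measurable
    ultimately show ?thesis by simp
  qed
  have HI: "integrable (?M \<Otimes>\<^sub>M ?M) (case_prod H)"
  proof (rule P.Fubini_integrable[OF Hm])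
    have "integrable ?M (\<lambda>x. \<bar>f x\<bar> * integral {x..b} (\<lambda>y. \<bar>g y\<bar>))"
      using f g by (intro integrable_mult_continuous indefinite_integral_continuous_1' integrable_on_lebesgue_on) auto
    moreover have "(LINT y|?M. norm (case (x, y) of (x, y) \<Rightarrow> H x y)) = \<bar>f x\<bar> * integral {x..b} (\<lambda>y. \<bar>g y\<bar>)"
      if "x \<in> {a..b}" for x
      using lebesgue_integral_indicator_mult(1)[OF integrable_abs[OF g] that]
      by (simp add: H_def abs_mult)
    ultimately show "integrable ?M (\<lambda>x. LINT y|?M. norm (case (x, y) of (x, y) \<Rightarrow> H x y))"
      by (subst Bochner_Integration.integrable_cong[OF refl]) auto
    show "AE x in ?M. integrable ?M (\<lambda>y. case (x, y) of (x, y) \<Rightarrow> H x y)"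
      unfolding H_def using g by (auto intro!: integrable_indicator_mult)
  qed
  have int: "integrable ?M (\<lambda>t. f t * integral {a..t} g)" "integrable ?M (\<lambda>t. g t * integral {a..t} f)"
    using f g by (intro integrable_mult_continuous continuous_on_indefinite_integral; simp)+
  have "(LINT y|?M. g y * integral {a..y} f) = (LINT y|?M. LINT x|?M. H x y)"
    by (intro Bochner_Integration.integral_cong[OF refl])
      (simp add: H' lebesgue_integral_indicator_mult(2)[OF f])
  also have "\<dots> = (LINT x|?M. LINT y|?M. H x y)"
    by (rule P.Fubini_integral[OF HI])
  also have "\<dots> = (LINT x|?M. f x * integral {a..b} g - f x * integral {a..x} g)"
  proof (rule Bochner_Integration.integral_cong[OF refl])
    fix x assume "x \<in> space ?M"
    then have x: "x \<in> {a..b}" by simp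
    have "(LINT y|?M. H x y) = f x * integral {x..b} g"
      unfolding H_def using lebesgue_integral_indicator_mult(1)[OF g x] by simp
    also have "integral {x..b} g = integral {a..b} g - integral {a..x} g"
      using integral_diff_subinterval[OF g, of x b] x by simp
    finally show "(LINT y|?M. H x y) = f x * integral {a..b} g - f x * integral {a..x} g"
      by (simp add: right_diff_distrib)
  qed
  also have "\<dots> = integral {a..b} f * integral {a..b} g - (LINT x|?M. f x * integral {a..x} g)"
    using f int(1) by (simp add: lebesgue_integral_eq_integral)
  finally have "integral {a..b} f * integral {a..b} g
      = (LINT t|?M. f t * integral {a..t} g + g t * integral {a..t} f)"
    using int by simp
  then show ?thesis
    using int lebesgue_integral_eq_integral[OF Bochner_Integration.integrable_add[OF int]]
    by (simp add: mult.commute)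
qed

lemma indefinite_integral_mult:
  fixes f g A B :: "real \<Rightarrow> real"
  assumes f: "integrable (lebesgue_on {a..b}) f" and g: "integrable (lebesgue_on {a..b}) g"
    and A: "\<And>t. t \<in> {a..b} \<Longrightarrow> A t = A a + integral {a..t} f"
    and B: "\<And>t. t \<in> {a..b} \<Longrightarrow> B t = B a + integral {a..t} g"
    and t: "t \<in> {a..b}"
  shows "A t * B t = A a * B a + integral {a..t} (\<lambda>s. f s * B s + A s * g s)"
proof -
  have sub: "{a..t} \<subseteq> {a..b}" using t by auto
  have f': "integrable (lebesgue_on {a..t}) f" and g': "integrable (lebesgue_on {a..t}) g"
    using integrable_subinterval f g sub by blast+
  have fi: "f integrable_on {a..t}" and gi: "g integrable_on {a..t}"
    using f' g' by (simp_all add: integrable_on_lebesgue_on)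
  have fG: "(\<lambda>s. f s * integral {a..s} g + integral {a..s} f * g s) integrable_on {a..t}"
  proof -
    have "integrable (lebesgue_on {a..t}) (\<lambda>s. f s * integral {a..s} g)"
      "integrable (lebesgue_on {a..t}) (\<lambda>s. g s * integral {a..s} f)"
      using f' g' by (intro integrable_mult_continuous continuous_on_indefinite_integral; simp)+
    then show ?thesis
      by (intro integrable_on_lebesgue_on) (simp_all add: mult.commute)
  qed
  have "integral {a..t} (\<lambda>s. f s * B s + A s * g s)
      = integral {a..t} (\<lambda>s. (f s * integral {a..s} g + integral {a..s} f * g s) + (B a * f s + A a * g s))"
    by (intro integral_cong, subst A, use t in simp, subst B, use t in simp) (simp add: algebra_simps)
  also have "\<dots> = integral {a..t} f * integral {a..t} g + (B a * integral {a..t} f + A a * integral {a..t} g)"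
    using mult_indefinite_integrals[OF f' g'] fi gi fG
    by (simp add: Henstock_Kurzweil_Integration.integral_add Henstock_Kurzweil_Integration.integrable_add
        integrable_on_mult_right)
  finally show ?thesis
    using A[OF t] B[OF t] by (simp add: algebra_simps)
qed

text \<open>
  This evaluates the iterated integrals that bound the Picard iterates. The chain rule would give it
  at once if \<open>k\<close> were continuous; for integrable \<open>k\<close> it follows from integration by parts by induction.
\<close>
lemma integral_mult_power_primitive:
  fixes k :: "real \<Rightarrow> real"
  assumes k: "integrable (lebesgue_on {a..b}) k" and t: "t \<in> {a..b}"
  shows "integral {a..t} (\<lambda>s. k s * integral {a..s} k ^ n) = integral {a..t} k ^ Suc n / Suc n"
  using t
proof (induction n arbitrary: t)
  case 0
  then show ?case by simp
next
  case (Suc n)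
  let ?K = "\<lambda>t. integral {a..t} k"
  have int: "integrable (lebesgue_on {a..b}) (\<lambda>s. Suc n * (k s * ?K s ^ n))"
    by (intro integrable_mult_right integrable_mult_continuous k continuous_on_power
        continuous_on_indefinite_integral)
  have "?K t ^ Suc n * ?K t = ?K a ^ Suc n * ?K a
      + integral {a..t} (\<lambda>s. Suc n * (k s * ?K s ^ n) * ?K s + ?K s ^ Suc n * k s)"
  proof (rule indefinite_integral_mult[OF int k _ _ Suc.prems])
    show "?K t ^ Suc n = ?K a ^ Suc n + integral {a..t} (\<lambda>s. Suc n * (k s * ?K s ^ n))"
      if "t \<in> {a..b}" for t
      using Suc.IH[OF that] by simp
  qed simp
  also have "(\<lambda>s. Suc n * (k s * ?K s ^ n) * ?K s + ?K s ^ Suc n * k s)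
      = (\<lambda>s. Suc (Suc n) * (k s * ?K s ^ Suc n))"
    by (simp add: fun_eq_iff algebra_simps)
  also have "integral {a..t} \<dots> = Suc (Suc n) * integral {a..t} (\<lambda>s. k s * ?K s ^ Suc n)"
    by (rule integral_mult_right)
  finally have "?K t ^ Suc (Suc n) = Suc (Suc n) * integral {a..t} (\<lambda>s. k s * ?K s ^ Suc n)"
    by (simp add: mult.commute)
  then show ?case by (simp add: eq_divide_eq mult.commute del: power_Suc of_nat_Suc)
qed

lemma sums_integral_mult:
  fixes v :: "nat \<Rightarrow> real \<Rightarrow> real" and w :: "real \<Rightarrow> real"
  assumes w: "integrable (lebesgue_on {a..b}) w"
    and v: "\<And>n. continuous_on {a..b} (v n)"
    and m: "\<And>n t. t \<in> {a..b} \<Longrightarrow> \<bar>v n t\<bar> \<le> m n" "summable m"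
    and t: "t \<in> {a..b}"
  shows "(\<lambda>n. integral {a..t} (\<lambda>s. w s * v n s)) sums integral {a..t} (\<lambda>s. w s * (\<Sum>n. v n s))"
proof -
  let ?M = "lebesgue_on {a..t}"
  have sub: "{a..t} \<subseteq> {a..b}" using t by auto
  have w': "integrable ?M w" using integrable_subinterval w sub by blast
  have wv: "integrable ?M (\<lambda>s. w s * v n s)" for n
    by (intro integrable_mult_continuous w' continuous_on_subset[OF v sub])
  have vs: "summable (\<lambda>n. \<bar>v n s\<bar>)" if "s \<in> {a..t}" for s
    by (rule summable_comparison_test'[OF m(2), of 0]) (use m(1) that sub in auto)
  have ws: "summable (\<lambda>n. norm (w s * v n s))" if "s \<in> {a..t}" for s
    using vs[OF that] by (simp add: abs_mult summable_mult)
  have sm: "summable (\<lambda>n. LINT s|?M. norm (w s * v n s))"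
  proof (rule summable_comparison_test'[of "\<lambda>n. m n * (LINT s|?M. \<bar>w s\<bar>)" 0])
    show "summable (\<lambda>n. m n * (LINT s|?M. \<bar>w s\<bar>))" using m(2) by (rule summable_mult2)
    fix n
    have "(LINT s|?M. norm (w s * v n s)) \<le> (LINT s|?M. m n * \<bar>w s\<bar>)"
    proof (rule integral_mono)
      fix s assume "s \<in> space ?M"
      then have "\<bar>v n s\<bar> \<le> m n" using m(1) sub by auto
      then have "\<bar>v n s\<bar> * \<bar>w s\<bar> \<le> m n * \<bar>w s\<bar>" by (rule mult_right_mono) simp
      then show "norm (w s * v n s) \<le> m n * \<bar>w s\<bar>"
        by (simp add: abs_mult mult.commute)
    qed (use wv w' in auto)
    then show "norm (LINT s|?M. norm (w s * v n s)) \<le> m n * (LINT s|?M. \<bar>w s\<bar>)"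
      using w' by simp
  qed
  have "(\<lambda>n. LINT s|?M. w s * v n s) sums (LINT s|?M. (\<Sum>n. w s * v n s))"
    using wv ws sm by (intro sums_integral) auto
  moreover have "(LINT s|?M. (\<Sum>n. w s * v n s)) = integral {a..t} (\<lambda>s. \<Sum>n. w s * v n s)"
    using wv ws sm by (intro lebesgue_integral_eq_integral integrable_suminf) auto
  moreover have "integral {a..t} (\<lambda>s. \<Sum>n. w s * v n s) = integral {a..t} (\<lambda>s. w s * (\<Sum>n. v n s))"
    by (rule integral_cong, rule suminf_mult, rule summable_rabs_cancel, rule vs)
  ultimately show ?thesis
    using wv by (simp add: lebesgue_integral_eq_integral)
qed

section \<open>The initial value problem in integral form\<close>

text \<open>
  This is \<open>u'' + q u = \<sigma>\<close> as a first-order system for \<open>(u, p)\<close> with \<open>p = u'\<close>, in integrated form: the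
  integral calculus above applies to it directly, without exceptional null sets.
\<close>
definition integral_solution ::
  "(real \<Rightarrow> real) \<Rightarrow> (real \<Rightarrow> real) \<Rightarrow> (real \<Rightarrow> real) \<Rightarrow> (real \<Rightarrow> real) \<Rightarrow> bool" where
  "integral_solution q \<sigma> u p \<longleftrightarrow>
     continuous_on {0..1} u \<and> continuous_on {0..1} p \<and>
     (\<forall>t\<in>{0..1}. u t = u 0 + integral {0..t} p \<and>
                 p t = p 0 + integral {0..t} (\<lambda>s. \<sigma> s - q s * u s))"

lemma integral_solutionD:
  assumes "integral_solution q \<sigma> u p"
  shows "continuous_on {0..1} u" "continuous_on {0..1} p"
    "t \<in> {0..1} \<Longrightarrow> u t = u 0 + integral {0..t} p"
    "t \<in> {0..1} \<Longrightarrow> p t = p 0 + integral {0..t} (\<lambda>s. \<sigma> s - q s * u s)"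
  using assms unfolding integral_solution_def by blast+

text \<open>
  The increments of the Picard iteration for the homogeneous system, started at \<open>(u\<^sub>0, p\<^sub>0)\<close>; the
  solution is their sum. The right-hand side \<open>\<sigma>\<close> enters only through \<open>p\<^sub>0\<close>.
\<close>
primrec picard :: "(real \<Rightarrow> real) \<Rightarrow> (real \<Rightarrow> real) \<Rightarrow> (real \<Rightarrow> real) \<Rightarrow> nat \<Rightarrow> (real \<Rightarrow> real) \<times> (real \<Rightarrow> real)" where
  "picard q u\<^sub>0 p\<^sub>0 0 = (u\<^sub>0, p\<^sub>0)"
| "picard q u\<^sub>0 p\<^sub>0 (Suc n) =
     (\<lambda>t. integral {0..t} (snd (picard q u\<^sub>0 p\<^sub>0 n)),
      \<lambda>t. - integral {0..t} (\<lambda>s. q s * fst (picard q u\<^sub>0 p\<^sub>0 n) s))"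

lemma continuous_on_picard:
  assumes q: "integrable (lebesgue_on {0..1}) q"
    and u0: "continuous_on {0..1} u\<^sub>0" and p0: "continuous_on {0..1} p\<^sub>0"
  shows "continuous_on {0..1} (fst (picard q u\<^sub>0 p\<^sub>0 n)) \<and> continuous_on {0..1} (snd (picard q u\<^sub>0 p\<^sub>0 n))"
proof (induction n)
  case (Suc n)
  then have "continuous_on {0..1} (\<lambda>t. integral {0..t} (snd (picard q u\<^sub>0 p\<^sub>0 n)))"
    "continuous_on {0..1} (\<lambda>t. integral {0..t} (\<lambda>s. q s * fst (picard q u\<^sub>0 p\<^sub>0 n) s))"
    by (intro continuous_on_indefinite_integral integrable_mult_continuous q
        continuous_imp_integrable_real; simp)+
  then show ?case by (simp add: continuous_on_minus)
qed (use u0 p0 in simp)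

text \<open>
  With \<open>K t\<close> the integral of \<open>k = 1 + \<bar>q\<bar>\<close> over \<open>[0, t]\<close>, one step multiplies by at most \<open>k\<close> and integrates,
  which turns \<open>K ^ n / fact n\<close> into \<open>K ^ Suc n / fact (Suc n)\<close>. The \<open>1\<close> in \<open>k\<close> dominates the
  integration of \<open>p\<close>, the \<open>\<bar>q\<bar>\<close> that of \<open>q u\<close>.
\<close>
lemma picard_bound:
  assumes q: "integrable (lebesgue_on {0..1}) q"
    and u0: "continuous_on {0..1} u\<^sub>0" and p0: "continuous_on {0..1} p\<^sub>0"
    and M: "\<And>t. t \<in> {0..1} \<Longrightarrow> \<bar>u\<^sub>0 t\<bar> \<le> M \<and> \<bar>p\<^sub>0 t\<bar> \<le> M"
    and t: "t \<in> {0..1}"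
  shows "\<bar>fst (picard q u\<^sub>0 p\<^sub>0 n) t\<bar> \<le> M * integral {0..t} (\<lambda>s. 1 + \<bar>q s\<bar>) ^ n / fact n \<and>
         \<bar>snd (picard q u\<^sub>0 p\<^sub>0 n) t\<bar> \<le> M * integral {0..t} (\<lambda>s. 1 + \<bar>q s\<bar>) ^ n / fact n"
  using t
proof (induction n arbitrary: t)
  case 0
  then show ?case using M by simp
next
  case (Suc n)
  define k where "k s = 1 + \<bar>q s\<bar>" for s
  define u where "u = fst (picard q u\<^sub>0 p\<^sub>0 n)"
  define p where "p = snd (picard q u\<^sub>0 p\<^sub>0 n)"
  let ?B = "\<lambda>t. M * integral {0..t} k ^ n / fact n"
  have sub: "{0..t} \<subseteq> {0..1}" using Suc.prems by auto
  have k: "integrable (lebesgue_on {0..1}) k"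
    unfolding k_def using q by (auto intro!: Bochner_Integration.integrable_add continuous_imp_integrable_real)
  have cont: "continuous_on {0..1} u" "continuous_on {0..1} p"
    using continuous_on_picard[OF q u0 p0] by (auto simp: u_def p_def)
  have bu: "\<bar>u s\<bar> \<le> ?B s" and bp: "\<bar>p s\<bar> \<le> ?B s" if "s \<in> {0..t}" for s
    using Suc.IH[of s] that sub unfolding u_def p_def k_def by auto
  have B0: "0 \<le> ?B s" if "s \<in> {0..t}" for s
    using bu[OF that] by linarith
  have int: "integrable (lebesgue_on {0..1}) (\<lambda>s. k s * ?B s)"
    by (intro integrable_mult_continuous k continuous_intros continuous_on_indefinite_integral) auto
  have intB: "(\<lambda>s. k s * ?B s) integrable_on {0..t}"
    by (rule integrable_on_subinterval_real[OF int sub])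
  have val: "integral {0..t} (\<lambda>s. k s * ?B s) = M * integral {0..t} k ^ Suc n / fact (Suc n)"
  proof -
    have "(\<lambda>s. k s * ?B s) = (\<lambda>s. (M / fact n) * (k s * integral {0..s} k ^ n))"
      by (simp add: fun_eq_iff)
    then have "integral {0..t} (\<lambda>s. k s * ?B s) = integral {0..t} (\<lambda>s. (M / fact n) * (k s * integral {0..s} k ^ n))"
      by simp
    then show ?thesis
      unfolding integral_mult_right integral_mult_power_primitive[OF k Suc.prems, of n]
      by (simp add: mult.commute)
  qed
  have k1: "1 \<le> k s" "\<bar>q s\<bar> \<le> k s" for s by (auto simp: k_def)
  have "\<bar>integral {0..t} p\<bar> \<le> integral {0..t} (\<lambda>s. k s * ?B s)"
  proof (rule integral_norm_bound_integral[where 'a=real and 'n=real, unfolded real_norm_def])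
    show "p integrable_on {0..t}"
      by (rule integrable_on_subinterval_real[OF continuous_imp_integrable_real[OF cont(2)] sub])
    show "\<bar>p s\<bar> \<le> k s * ?B s" if "s \<in> {0..t}" for s
      using bp[OF that] mult_right_mono[OF k1(1) B0[OF that], of s] by simp
  qed (rule intB)
  moreover have "\<bar>integral {0..t} (\<lambda>s. q s * u s)\<bar> \<le> integral {0..t} (\<lambda>s. k s * ?B s)"
  proof (rule integral_norm_bound_integral[where 'a=real and 'n=real, unfolded real_norm_def])
    show "(\<lambda>s. q s * u s) integrable_on {0..t}"
      by (rule integrable_on_subinterval_real[OF integrable_mult_continuous[OF q cont(1)] sub])
    show "\<bar>q s * u s\<bar> \<le> k s * ?B s" if "s \<in> {0..t}" for s
      unfolding abs_mult by (intro mult_mono k1 bu[OF that]) (simp_all add: k_def)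
  qed (rule intB)
  ultimately show ?case
    unfolding val by (simp add: u_def p_def k_def[abs_def])
qed

text \<open>
  The Picard increments are dominated by the terms of an exponential series, so their sum converges
  uniformly and may be integrated term by term against \<open>1\<close> and against the integrable function \<open>q\<close>.
\<close>
theorem integral_solution_exists:
  assumes q: "integrable (lebesgue_on {0..1}) q" and \<sigma>: "integrable (lebesgue_on {0..1}) \<sigma>"
  obtains u p where "integral_solution q \<sigma> u p" "u 0 = b" "p 0 = c"
proof -
  define p0 where "p0 t = c + integral {0..t} \<sigma>" for t
  define z where "z n = picard q (\<lambda>_. b) p0 n" for n
  let ?I = "{0..1::real}"
  have p0: "continuous_on ?I p0"
    unfolding p0_def by (intro continuous_intros continuous_on_indefinite_integral \<sigma>)
  have cb: "continuous_on ?I (\<lambda>_. b)" by simp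
  obtain M where M: "\<And>t. t \<in> ?I \<Longrightarrow> \<bar>b\<bar> \<le> M \<and> \<bar>p0 t\<bar> \<le> M"
  proof -
    have "bounded (p0 ` ?I)" using compact_continuous_image[OF p0] compact_imp_bounded by blast
    then obtain B where "\<And>t. t \<in> ?I \<Longrightarrow> \<bar>p0 t\<bar> \<le> B" unfolding bounded_iff by (metis imageI real_norm_def)
    then show thesis by (intro that[of "max \<bar>b\<bar> B"]) (auto intro: max.coboundedI2)
  qed
  define \<kappa> where "\<kappa> = integral ?I (\<lambda>s. 1 + \<bar>q s\<bar>)"
  define m where "m n = M * \<kappa> ^ n / fact n" for n
  have k: "integrable (lebesgue_on ?I) (\<lambda>s. 1 + \<bar>q s\<bar>)"
    using q by (auto intro!: Bochner_Integration.integrable_add continuous_imp_integrable_real)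
  have M0: "0 \<le> M" using M[of 0] by auto
  have bound: "\<bar>fst (z n) t\<bar> \<le> m n" "\<bar>snd (z n) t\<bar> \<le> m n" if t: "t \<in> ?I" for n t
  proof -
    let ?K = "integral {0..t} (\<lambda>s. 1 + \<bar>q s\<bar>)"
    have K: "0 \<le> ?K" "?K \<le> \<kappa>"
      unfolding \<kappa>_def using t
      by (auto intro!: integral_nonneg integral_subset_le integrable_on_subinterval_real[OF k])
    then have "M * ?K ^ n / fact n \<le> m n"
      unfolding m_def using M0 by (intro divide_right_mono mult_left_mono power_mono) auto
    then show "\<bar>fst (z n) t\<bar> \<le> m n" "\<bar>snd (z n) t\<bar> \<le> m n"
      using picard_bound[OF q cb p0 M t, of n] unfolding z_def by linarith+
  qed
  have m: "summable m"
    using summable_mult[OF summable_exp[of \<kappa>], of M] unfolding m_def by (simp add: field_simps)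
  have zc: "continuous_on ?I (fst (z n))" "continuous_on ?I (snd (z n))" for n
    using continuous_on_picard[OF q cb p0] by (auto simp: z_def)
  define u where "u t = (\<Sum>n. fst (z n) t)" for t
  define p where "p t = (\<Sum>n. snd (z n) t)" for t
  have cont: "continuous_on ?I (\<lambda>t. \<Sum>n. f n t)"
    if f: "\<And>n. continuous_on ?I (f n)" "\<And>n t. t \<in> ?I \<Longrightarrow> \<bar>f n t\<bar> \<le> m n" for f :: "nat \<Rightarrow> real \<Rightarrow> real"
  proof (rule uniform_limit_theorem)
    show "uniform_limit ?I (\<lambda>n t. \<Sum>i<n. f i t) (\<lambda>t. \<Sum>n. f n t) sequentially"
      using f(2) m by (intro Weierstrass_m_test) auto
    show "\<forall>\<^sub>F n in sequentially. continuous_on ?I (\<lambda>t. \<Sum>i<n. f i t)"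
      by (intro always_eventually allI continuous_intros f(1))
  qed simp
  have uc: "continuous_on ?I u"
    unfolding u_def by (rule cont[OF zc(1) bound(1)])
  have pc: "continuous_on ?I p"
    unfolding p_def by (rule cont[OF zc(2) bound(2)])
  have summ: "summable (\<lambda>n. fst (z n) t)" "summable (\<lambda>n. snd (z n) t)" if "t \<in> ?I" for t
    using bound[OF that] by (intro summable_comparison_test'[OF m, of 0]; simp)+
  have ueq: "u t = b + integral {0..t} p" if t: "t \<in> ?I" for t
  proof -
    have "(\<lambda>n. integral {0..t} (\<lambda>s. 1 * snd (z n) s)) sums integral {0..t} (\<lambda>s. 1 * (\<Sum>n. snd (z n) s))"
      by (rule sums_integral_mult[OF _ zc(2) bound(2) m t]) (auto intro: continuous_imp_integrable_real)
    moreover have "(\<lambda>s. 1 * (\<Sum>n. snd (z n) s)) = p"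
      by (simp add: p_def fun_eq_iff)
    moreover have "fst (z (Suc n)) t = integral {0..t} (\<lambda>s. 1 * snd (z n) s)" for n
      by (simp add: z_def)
    ultimately have "(\<Sum>n. fst (z (Suc n)) t) = integral {0..t} p"
      by (simp only: sums_iff)
    then show ?thesis
      using suminf_split_head[OF summ(1)[OF t]] by (simp add: u_def z_def)
  qed
  have peq: "p t = c + integral {0..t} (\<lambda>s. \<sigma> s - q s * u s)" if t: "t \<in> ?I" for t
  proof -
    have sub: "{0..t} \<subseteq> ?I" using t by auto
    have "(\<lambda>n. integral {0..t} (\<lambda>s. q s * fst (z n) s)) sums integral {0..t} (\<lambda>s. q s * u s)"
      unfolding u_def by (rule sums_integral_mult[OF q zc(1) bound(1) m t])
    then have "(\<lambda>n. - integral {0..t} (\<lambda>s. q s * fst (z n) s)) sums - integral {0..t} (\<lambda>s. q s * u s)"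
      by (rule sums_minus)
    moreover have "snd (z (Suc n)) t = - integral {0..t} (\<lambda>s. q s * fst (z n) s)" for n
      by (simp add: z_def)
    ultimately have "(\<Sum>n. snd (z (Suc n)) t) = - integral {0..t} (\<lambda>s. q s * u s)"
      by (simp only: sums_iff)
    then have "p t = c + (integral {0..t} \<sigma> - integral {0..t} (\<lambda>s. q s * u s))"
      using suminf_split_head[OF summ(2)[OF t]] by (simp add: p_def z_def p0_def)
    also have "integral {0..t} \<sigma> - integral {0..t} (\<lambda>s. q s * u s) = integral {0..t} (\<lambda>s. \<sigma> s - q s * u s)"
      by (rule integral_diff[symmetric])
        (intro integrable_on_subinterval_real[OF _ sub] \<sigma> integrable_mult_continuous q uc)+
    finally show ?thesis .
  qed
  have u0: "u 0 = b" and p0': "p 0 = c"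
    using ueq[of 0] peq[of 0] by auto
  show thesis
  proof (rule that[of u p])
    show "integral_solution q \<sigma> u p"
      unfolding integral_solution_def using uc pc ueq peq u0 p0' by (simp del: atLeastAtMost_iff)
  qed (rule u0 p0')+
qed

lemma integral_solution_add_scaled:
  assumes q: "integrable (lebesgue_on {0..1}) q"
    and \<sigma>: "integrable (lebesgue_on {0..1}) \<sigma>" and \<tau>: "integrable (lebesgue_on {0..1}) \<tau>"
    and u: "integral_solution q \<sigma> u p" and v: "integral_solution q \<tau> v r"
  shows "integral_solution q (\<lambda>t. \<sigma> t + c * \<tau> t) (\<lambda>t. u t + c * v t) (\<lambda>t. p t + c * r t)"
proof -
  have cont: "continuous_on {0..1} u" "continuous_on {0..1} p" "continuous_on {0..1} v" "continuous_on {0..1} r"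
    by (fact integral_solutionD(1,2)[OF u] integral_solutionD(1,2)[OF v])+
  have int_p: "integral {0..t} (\<lambda>s. p s + c * r s) = integral {0..t} p + c * integral {0..t} r" if "t \<in> {0..1}" for t
  proof -
    have "{0..t} \<subseteq> {0..1}" using that by auto
    then have "p integrable_on {0..t}" "r integrable_on {0..t}"
      using cont by (auto intro!: integrable_continuous_real intro: continuous_on_subset)
    then show ?thesis by (simp add: Henstock_Kurzweil_Integration.integral_add integrable_on_mult_right)
  qed
  have int_rhs: "integral {0..t} (\<lambda>s. (\<sigma> s + c * \<tau> s) - q s * (u s + c * v s))
      = integral {0..t} (\<lambda>s. \<sigma> s - q s * u s) + c * integral {0..t} (\<lambda>s. \<tau> s - q s * v s)"
    if "t \<in> {0..1}" for t
  proof -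
    have sub: "{0..t} \<subseteq> {0..1}" using that by auto
    have "(\<lambda>s. \<sigma> s - q s * u s) integrable_on {0..t}" "(\<lambda>s. \<tau> s - q s * v s) integrable_on {0..t}"
      by (intro integrable_on_subinterval_real[OF _ sub] Bochner_Integration.integrable_diff
          integrable_mult_continuous q \<sigma> \<tau> cont)+
    then have "integral {0..t} (\<lambda>s. (\<sigma> s - q s * u s) + c * (\<tau> s - q s * v s))
      = integral {0..t} (\<lambda>s. \<sigma> s - q s * u s) + c * integral {0..t} (\<lambda>s. \<tau> s - q s * v s)"
      by (simp add: Henstock_Kurzweil_Integration.integral_add integrable_on_mult_right)
    then show ?thesis by (simp add: algebra_simps)
  qed
  show ?thesis
    unfolding integral_solution_def
  proof (intro conjI ballI)
    fix t :: real assume t: "t \<in> {0..1}"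
    show "u t + c * v t = u 0 + c * v 0 + integral {0..t} (\<lambda>s. p s + c * r s)"
      using integral_solutionD(3)[OF u t] integral_solutionD(3)[OF v t] int_p[OF t]
      by (simp add: distrib_left)
    show "p t + c * r t = p 0 + c * r 0 + integral {0..t} (\<lambda>s. \<sigma> s + c * \<tau> s - q s * (u s + c * v s))"
      using integral_solutionD(4)[OF u t] integral_solutionD(4)[OF v t] int_rhs[OF t]
      by (simp add: distrib_left)
  qed (intro continuous_intros cont)+
qed

text \<open>
  Formally \<open>(v u' - v' u)' = v u'' - v'' u = v \<sigma>\<close>, the terms with \<open>q\<close> cancelling. For \<open>\<sigma> = 0\<close> this is the
  constancy of the Wronskian.
\<close>
lemma lagrange_identity:
  assumes q: "integrable (lebesgue_on {0..1}) q" and \<sigma>: "integrable (lebesgue_on {0..1}) \<sigma>"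
    and u: "integral_solution q \<sigma> u p" and v: "integral_solution q (\<lambda>_. 0) v r" and t: "t \<in> {0..1}"
  shows "v t * p t - r t * u t = v 0 * p 0 - r 0 * u 0 + integral {0..t} (\<lambda>s. v s * \<sigma> s)"
proof -
  have cont: "continuous_on {0..1} u" "continuous_on {0..1} p" "continuous_on {0..1} v" "continuous_on {0..1} r"
    by (fact integral_solutionD(1,2)[OF u] integral_solutionD(1,2)[OF v])+
  have sub: "{0..t} \<subseteq> {0..1}" using t by auto
  have ip: "integrable (lebesgue_on {0..1}) (\<lambda>s. \<sigma> s - q s * u s)"
    and ir: "integrable (lebesgue_on {0..1}) (\<lambda>s. 0 - q s * v s)"
    using \<sigma> by (intro Bochner_Integration.integrable_diff integrable_mult_continuous q cont; simp)+
  have vp: "v t * p t = v 0 * p 0 + integral {0..t} (\<lambda>s. r s * p s + v s * (\<sigma> s - q s * u s))"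
    by (rule indefinite_integral_mult[OF continuous_imp_integrable_real[OF cont(4)] ip
          integral_solutionD(3)[OF v] integral_solutionD(4)[OF u] t])
  have ru: "r t * u t = r 0 * u 0 + integral {0..t} (\<lambda>s. (0 - q s * v s) * u s + r s * p s)"
    by (rule indefinite_integral_mult[OF ir continuous_imp_integrable_real[OF cont(2)]
          integral_solutionD(4)[OF v] integral_solutionD(3)[OF u] t])
  have rp: "integrable (lebesgue_on {0..1}) (\<lambda>s. r s * p s)"
    by (intro continuous_imp_integrable_real continuous_intros cont)
  have "integrable (lebesgue_on {0..1}) (\<lambda>s. r s * p s + v s * (\<sigma> s - q s * u s))"
    using Bochner_Integration.integrable_add[OF rp integrable_mult_continuous[OF ip cont(3)]]
    by (simp add: mult.commute)
  moreover have "integrable (lebesgue_on {0..1}) (\<lambda>s. (0 - q s * v s) * u s + r s * p s)"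
    by (intro Bochner_Integration.integrable_add rp integrable_mult_continuous ir cont)
  ultimately have "integral {0..t} (\<lambda>s. r s * p s + v s * (\<sigma> s - q s * u s))
      - integral {0..t} (\<lambda>s. (0 - q s * v s) * u s + r s * p s)
      = integral {0..t} (\<lambda>s. (r s * p s + v s * (\<sigma> s - q s * u s)) - ((0 - q s * v s) * u s + r s * p s))"
    by (intro integral_diff[symmetric] integrable_on_subinterval_real[OF _ sub])
  also have "\<dots> = integral {0..t} (\<lambda>s. v s * \<sigma> s)"
    by (simp add: algebra_simps)
  finally show ?thesis using vp ru by simp
qed

section \<open>The space W21 and the differential equation\<close>

lemma has_real_derivative_cong_on:
  assumes "t \<in> S" "\<And>x. x \<in> S \<Longrightarrow> f x = g x" "(f has_real_derivative d) (at t within S)"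
  shows "(g has_real_derivative d) (at t within S)"
  unfolding has_field_derivative_def
proof (rule has_derivative_transform[OF assms(1)])
  show "g x = f x" if "x \<in> S" for x using assms(2)[OF that] by simp
  show "(f has_derivative (*) d) (at t within S)" using assms(3) by (simp add: has_field_derivative_def)
qed

lemma D_eqI:
  assumes "(f has_real_derivative d) (at t within {0..1})" "t \<in> {0..1}"
  shows "D f t = d"
  unfolding D_def using assms
  by (intro vector_derivative_within_closed_interval) (auto simp: has_real_derivative_iff_has_vector_derivative)

lemma D_cong:
  assumes fg: "\<And>t. t \<in> {0..1} \<Longrightarrow> f t = g t" and t: "t \<in> {0..1}"
  shows "D f t = D g t"
proof -
  have "(f has_real_derivative d) (at t within {0..1}) \<longleftrightarrow> (g has_real_derivative d) (at t within {0..1})" for d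
    using has_real_derivative_cong_on[of t "{0..1}"] fg t by metis
  then show ?thesis
    unfolding D_def vector_derivative_def has_real_derivative_iff_has_vector_derivative by simp
qed

lemma abs_continuous_on_cong:
  assumes f: "abs_continuous_on S f" and fg: "\<And>t. t \<in> S \<Longrightarrow> f t = g t"
  shows "abs_continuous_on S g"
proof -
  have *: "(\<Sum>i<n. \<bar>g (y i) - g (x i)\<bar>) = (\<Sum>i<n. \<bar>f (y i) - f (x i)\<bar>)"
    if H: "\<forall>i<n. x i \<le> y i \<and> {x i..y i} \<subseteq> S" for n :: nat and x y :: "nat \<Rightarrow> real"
  proof (rule sum.cong[OF refl])
    fix i assume "i \<in> {..<n}"
    then have "x i \<le> y i" "{x i..y i} \<subseteq> S" using H by simp_all
    then have "x i \<in> S" "y i \<in> S" by auto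
    then show "\<bar>g (y i) - g (x i)\<bar> = \<bar>f (y i) - f (x i)\<bar>" by (simp add: fg)
  qed
  show ?thesis
    using f unfolding abs_continuous_on_def by (simp add: * cong: conj_cong imp_cong)
qed

lemma abs_continuous_on_add_scaled:
  assumes f: "abs_continuous_on S f" and g: "abs_continuous_on S g"
  shows "abs_continuous_on S (\<lambda>t. f t + c * g t)"
  unfolding abs_continuous_on_def
proof (intro allI impI)
  fix \<epsilon> :: real assume \<epsilon>: "\<epsilon> > 0"
  \<comment> \<open>The \<open>+ 1\<close> keeps \<open>\<eta>\<close> positive and finite when \<open>c = 0\<close>.\<close>
  define \<eta> where "\<eta> = \<epsilon> / (2 * (\<bar>c\<bar> + 1))"
  have \<eta>: "\<eta> > 0" and c\<eta>: "\<bar>c\<bar> * \<eta> \<le> \<epsilon> / 2"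
    using \<epsilon> by (auto simp: \<eta>_def field_simps)
  let ?P = "\<lambda>\<delta> (n::nat) (x::nat \<Rightarrow> real) y. (\<forall>i<n. x i \<le> y i \<and> {x i..y i} \<subseteq> S) \<and>
      disjoint_family_on (\<lambda>i. {x i<..<y i}) {..<n} \<and> (\<Sum>i<n. y i - x i) < \<delta>"
  obtain \<delta> where \<delta>: "\<delta> > 0" "\<And>n x y. ?P \<delta> n x y \<Longrightarrow> (\<Sum>i<n. \<bar>f (y i) - f (x i)\<bar>) < \<epsilon> / 2"
    using f[unfolded abs_continuous_on_def, rule_format, OF half_gt_zero[OF \<epsilon>]] by blast
  obtain \<delta>' where \<delta>': "\<delta>' > 0" "\<And>n x y. ?P \<delta>' n x y \<Longrightarrow> (\<Sum>i<n. \<bar>g (y i) - g (x i)\<bar>) < \<eta>"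
    using g[unfolded abs_continuous_on_def, rule_format, OF \<eta>] by blast
  show "\<exists>\<delta>>0. \<forall>n x y. ?P \<delta> n x y \<longrightarrow>
      (\<Sum>i<n. \<bar>(f (y i) + c * g (y i)) - (f (x i) + c * g (x i))\<bar>) < \<epsilon>"
  proof (intro exI[of _ "min \<delta> \<delta>'"] conjI allI impI)
    fix n :: nat and x y :: "nat \<Rightarrow> real"
    assume H: "?P (min \<delta> \<delta>') n x y"
    have 1: "(\<Sum>i<n. \<bar>f (y i) - f (x i)\<bar>) < \<epsilon> / 2" by (rule \<delta>(2)) (use H in auto)
    have 2: "(\<Sum>i<n. \<bar>g (y i) - g (x i)\<bar>) < \<eta>" by (rule \<delta>'(2)) (use H in auto)
    have "(\<Sum>i<n. \<bar>(f (y i) + c * g (y i)) - (f (x i) + c * g (x i))\<bar>)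
        \<le> (\<Sum>i<n. \<bar>f (y i) - f (x i)\<bar> + \<bar>c\<bar> * \<bar>g (y i) - g (x i)\<bar>)"
    proof (intro sum_mono)
      fix i
      have "(f (y i) + c * g (y i)) - (f (x i) + c * g (x i)) = (f (y i) - f (x i)) + c * (g (y i) - g (x i))"
        by (simp add: algebra_simps)
      then show "\<bar>(f (y i) + c * g (y i)) - (f (x i) + c * g (x i))\<bar> \<le> \<bar>f (y i) - f (x i)\<bar> + \<bar>c\<bar> * \<bar>g (y i) - g (x i)\<bar>"
        by (metis abs_mult abs_triangle_ineq)
    qed
    also have "\<dots> = (\<Sum>i<n. \<bar>f (y i) - f (x i)\<bar>) + \<bar>c\<bar> * (\<Sum>i<n. \<bar>g (y i) - g (x i)\<bar>)"
      by (simp add: sum.distrib sum_distrib_left)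
    also have "\<dots> < \<epsilon>"
      using 1 mult_left_mono[OF less_imp_le[OF 2], of "\<bar>c\<bar>"] c\<eta> by simp
    finally show "(\<Sum>i<n. \<bar>(f (y i) + c * g (y i)) - (f (x i) + c * g (x i))\<bar>) < \<epsilon>" .
  qed (use \<delta> \<delta>' in auto)
qed

lemma W21_D:
  assumes "u \<in> W21" "t \<in> {0..1}"
  shows "(u has_real_derivative D u t) (at t within {0..1})"
  using assms unfolding W21_def D_def has_real_derivative_iff_has_vector_derivative
  by (simp add: vector_derivative_works)

lemma W21_cong:
  assumes "u \<in> W21" "\<And>t. t \<in> {0..1} \<Longrightarrow> u t = v t"
  shows "v \<in> W21"
  unfolding W21_def
proof (safe intro!: CollectI)
  show "continuous_on {0..1} v"
    using assms continuous_on_cong[of "{0..1}" "{0..1}" u v] by (auto simp: W21_def)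
  show "v differentiable (at t within {0..1})" if "t \<in> {0..1}" for t
    using has_real_derivative_cong_on[OF that assms(2) W21_D[OF assms(1) that]]
    by (auto intro: differentiableI_vector simp: has_real_derivative_iff_has_vector_derivative)
  show "abs_continuous_on {0..1} (D v)"
    using assms abs_continuous_on_cong[of "{0..1}" "D u" "D v"] D_cong[of u v] by (auto simp: W21_def)
qed

lemma L_eq_cong:
  assumes "L_eq a lam u \<sigma>" "\<And>t. t \<in> {0..1} \<Longrightarrow> u t = v t" "\<And>t. t \<in> {0..1} \<Longrightarrow> \<sigma> t = \<tau> t"
  shows "L_eq a lam v \<tau>"
  using assms(1) unfolding L_eq_def
proof (rule AE_mp, intro AE_I2 impI)
  fix t assume "t \<in> space (lebesgue_on {0..1})"
    and ex: "\<exists>w. (D u has_real_derivative w) (at t within {0..1}) \<and> w + (a t + lam) * u t = \<sigma> t"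
  then have t: "t \<in> {0..1}" by simp
  show "\<exists>w. (D v has_real_derivative w) (at t within {0..1}) \<and> w + (a t + lam) * v t = \<tau> t"
    using ex has_real_derivative_cong_on[OF t, of "D u" "D v"] D_cong[of u v, OF assms(2)]
      assms(2)[OF t] assms(3)[OF t] by metis
qed

lemma D_add_scaled:
  assumes u: "u \<in> W21" and v: "v \<in> W21" and t: "t \<in> {0..1}"
  shows "D (\<lambda>t. u t + c * v t) t = D u t + c * D v t"
  by (rule D_eqI[OF _ t]) (intro derivative_intros DERIV_cmult W21_D u v t)

lemma W21_add_scaled:
  assumes u: "u \<in> W21" and v: "v \<in> W21"
  shows "(\<lambda>t. u t + c * v t) \<in> W21"
  unfolding W21_def
proof (safe intro!: CollectI)
  show "continuous_on {0..1} (\<lambda>t. u t + c * v t)"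
    using u v by (intro continuous_intros) (auto simp: W21_def)
  show "(\<lambda>t. u t + c * v t) differentiable (at t within {0..1})" if "t \<in> {0..1}" for t
    using u v that by (intro derivative_intros) (auto simp: W21_def)
  have "abs_continuous_on {0..1} (\<lambda>t. D u t + c * D v t)"
    using u v by (intro abs_continuous_on_add_scaled) (auto simp: W21_def)
  then show "abs_continuous_on {0..1} (D (\<lambda>t. u t + c * v t))"
    by (rule abs_continuous_on_cong) (simp add: D_add_scaled u v)
qed

lemma L_eq_add_scaled:
  assumes u: "u \<in> W21" and v: "v \<in> W21" and "L_eq a lam u \<sigma>" "L_eq a lam v \<tau>"
  shows "L_eq a lam (\<lambda>t. u t + c * v t) (\<lambda>t. \<sigma> t + c * \<tau> t)"
proof -
  have "AE t in lebesgue_on {0..1}. t \<in> {0..1}" by (rule AE_I2) simp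
  with assms(3,4) show ?thesis unfolding L_eq_def
  proof eventually_elim
    case (elim t)
    then obtain w w' where w: "(D u has_real_derivative w) (at t within {0..1})" "w + (a t + lam) * u t = \<sigma> t"
      "(D v has_real_derivative w') (at t within {0..1})" "w' + (a t + lam) * v t = \<tau> t" by blast
    have "((\<lambda>t. D u t + c * D v t) has_real_derivative w + c * w') (at t within {0..1})"
      by (intro derivative_intros DERIV_cmult w)
    then have "(D (\<lambda>t. u t + c * v t) has_real_derivative w + c * w') (at t within {0..1})"
      by (rule has_real_derivative_cong_on[OF elim(3), rotated]) (simp add: D_add_scaled u v)
    moreover have "w + c * w' + (a t + lam) * (u t + c * v t) = \<sigma> t + c * \<tau> t"
      unfolding w(2,4)[symmetric] by (simp add: algebra_simps)
    ultimately show ?case by blast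
  qed
qed

lemma integral_solution_has_derivative:
  assumes u: "integral_solution q \<sigma> u p" and t: "t \<in> {0..1}"
  shows "(u has_real_derivative p t) (at t within {0..1})"
proof -
  have "((\<lambda>t. u 0 + integral {0..t} p) has_real_derivative 0 + p t) (at t within {0..1})"
    by (intro derivative_intros integral_has_real_derivative integral_solutionD(2)[OF u] t)
  then have "((\<lambda>t. u 0 + integral {0..t} p) has_real_derivative p t) (at t within {0..1})" by simp
  then show ?thesis
    by (rule has_real_derivative_cong_on[OF t, rotated]) (rule integral_solutionD(3)[OF u, symmetric])
qed

lemma D_integral_solution:
  assumes "integral_solution q \<sigma> u p" "t \<in> {0..1}"
  shows "D u t = p t"
  by (intro D_eqI integral_solution_has_derivative[OF assms] assms(2))

lemma integrable_integral_solution_rhs: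
  assumes "integrable (lebesgue_on {0..1}) q" "integrable (lebesgue_on {0..1}) \<sigma>"
    and "integral_solution q \<sigma> u p"
  shows "integrable (lebesgue_on {0..1}) (\<lambda>s. \<sigma> s - q s * u s)"
  by (intro Bochner_Integration.integrable_diff integrable_mult_continuous assms integral_solutionD(1)[OF assms(3)])

text \<open>
  Since \<open>D u = p\<close> is an indefinite integral, it is absolutely continuous.
\<close>
lemma W21_integral_solution:
  assumes q: "integrable (lebesgue_on {0..1}) q" and \<sigma>: "integrable (lebesgue_on {0..1}) \<sigma>"
    and u: "integral_solution q \<sigma> u p"
  shows "u \<in> W21"
  unfolding W21_def
proof (safe intro!: CollectI)
  show "continuous_on {0..1} u" by (rule integral_solutionD(1)[OF u])
  show "u differentiable (at t within {0..1})" if "t \<in> {0..1}" for t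
    using integral_solution_has_derivative[OF u that]
    by (auto intro: differentiableI_vector simp: has_real_derivative_iff_has_vector_derivative)
  have "abs_continuous_on {0..1} (\<lambda>t. p 0 + integral {0..t} (\<lambda>s. \<sigma> s - q s * u s))"
    by (rule abs_continuous_on_indefinite_integral[OF integrable_integral_solution_rhs[OF q \<sigma> u]])
  then show "abs_continuous_on {0..1} (D u)"
    by (rule abs_continuous_on_cong)
      (subst D_integral_solution[OF u], assumption, rule integral_solutionD(4)[OF u, symmetric])
qed

text \<open>
  Lebesgue's differentiation theorem, applied to the integral that defines \<open>p = D u\<close>.
\<close>
lemma L_eq_integral_solution:
  assumes a: "integrable (lebesgue_on {0..1}) (\<lambda>t. a t + lam)" and \<sigma>: "integrable (lebesgue_on {0..1}) \<sigma>"
    and u: "integral_solution (\<lambda>t. a t + lam) \<sigma> u p"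
  shows "L_eq a lam u \<sigma>"
  unfolding L_eq_def
proof -
  let ?h = "\<lambda>s. \<sigma> s - (a s + lam) * u s"
  have "AE t in lebesgue_on {0..1}. t \<in> {0..1}" by (rule AE_I2) simp
  with AE_has_real_derivative_indefinite_integral[OF integrable_integral_solution_rhs[OF a \<sigma> u]]
  show "AE t in lebesgue_on {0..1}. \<exists>w. (D u has_real_derivative w) (at t within {0..1}) \<and> w + (a t + lam) * u t = \<sigma> t"
  proof eventually_elim
    case (elim t)
    have "((\<lambda>t. p 0 + integral {0..t} ?h) has_real_derivative 0 + ?h t) (at t within {0..1})"
      by (intro derivative_intros elim)
    then have "(D u has_real_derivative 0 + ?h t) (at t within {0..1})"
      by (rule has_real_derivative_cong_on[OF elim(2), rotated])
        (subst D_integral_solution[OF u], assumption, rule integral_solutionD(4)[OF u, symmetric])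
    then show ?case by (intro exI[of _ "0 + ?h t"]) simp
  qed
qed

section \<open>Green's functions of a boundary condition\<close>

lemma ext01_eq:
  assumes g: "continuous_on {0..1} g" and fg: "\<And>t. t \<in> {0<..<1} \<Longrightarrow> f t = g t" and t: "t \<in> {0..1}"
  shows "ext01 f t = g t"
proof (cases "t \<in> {0<..<1}")
  case True
  then show ?thesis by (simp add: ext01_def fg)
next
  case False
  have "(g \<longlongrightarrow> g t) (at t within {0<..<1})"
  proof (rule tendsto_mono[OF at_le])
    show "(g \<longlongrightarrow> g t) (at t within {0..1})" using g t unfolding continuous_on_def by blast
  qed auto
  moreover have "\<forall>\<^sub>F x in at t within {0<..<1}. g x = f x"
    using fg by (auto simp: eventually_at_filter)
  ultimately have "(f \<longlongrightarrow> g t) (at t within {0<..<1})"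
    by (rule Lim_transform_eventually)
  moreover have "at t within {0<..<1} \<noteq> bot"
    using t islimpt_greaterThanLessThan1[of 0 "1::real"] islimpt_greaterThanLessThan2[of 0 "1::real"] False
    by (cases "t = 0") (auto simp: trivial_limit_within)
  ultimately show ?thesis
    unfolding ext01_def if_not_P[OF False] by (intro tendsto_Lim)
qed

text \<open>
  Testing both kernels against \<open>\<sigma> = G (t, \<cdot>) - H (t, \<cdot>)\<close> makes the integral of the continuous function
  \<open>\<sigma>\<^sup>2\<close> vanish.
\<close>
lemma is_green_unique:
  assumes G: "is_green X a lam G" and H: "is_green X a lam H"
    and ts: "t \<in> {0..1}" "s \<in> {0..1}"
  shows "G (t, s) = H (t, s)"
proof -
  let ?M = "lebesgue_on {0..1::real}"
  have c: "continuous_on {0..1} (\<lambda>s. F (t, s))" if "is_green X a lam F" for F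
  proof -
    have "continuous_on ({0..1} \<times> {0..1}) F" using that by (simp add: is_green_def)
    then show ?thesis
      using ts(1) by (intro continuous_on_compose2[of _ F _ "\<lambda>s. (t, s)"] continuous_intros) auto
  qed
  define \<sigma> where "\<sigma> s = G (t, s) - H (t, s)" for s
  have \<sigma>: "continuous_on {0..1} \<sigma>" unfolding \<sigma>_def by (intro continuous_intros c G H)
  have i\<sigma>: "integrable ?M \<sigma>" by (rule continuous_imp_integrable_real[OF \<sigma>])
  have "(LINT s|?M. G (t, s) * \<sigma> s) = (LINT s|?M. H (t, s) * \<sigma> s)"
    using G H i\<sigma> ts(1) unfolding is_green_def Let_def by blast
  then have "(LINT s|?M. G (t, s) * \<sigma> s - H (t, s) * \<sigma> s) = 0"
    by (subst Bochner_Integration.integral_diff)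
      (auto intro!: continuous_imp_integrable_real continuous_on_mult c G H \<sigma>)
  then have "(LINT s|?M. (\<sigma> s)\<^sup>2) = 0"
    by (simp add: \<sigma>_def power2_eq_square algebra_simps)
  then have "\<forall>s\<in>{0..1}. (\<sigma> s)\<^sup>2 = 0"
    using \<sigma> by (subst (asm) integralL_eq_0_iff) (auto intro!: continuous_intros)
  then show ?thesis using ts(2) by (simp add: \<sigma>_def)
qed

text \<open>
  What the arguments below need of a linear homogeneous boundary condition; closure under agreement on
  \<open>[0, 1]\<close> is included because functions are total and only these values matter.
\<close>
definition bvp_space :: "(real \<Rightarrow> real) set \<Rightarrow> bool" where
  "bvp_space X \<longleftrightarrow> X \<subseteq> W21 \<and>
     (\<forall>u v. u \<in> X \<longrightarrow> (\<forall>t\<in>{0..1}. u t = v t) \<longrightarrow> v \<in> X) \<and>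
     (\<forall>u\<in>X. \<forall>v\<in>X. \<forall>c. (\<lambda>t. u t + c * v t) \<in> X)"

lemma bvp_spaceD:
  assumes "bvp_space X"
  shows "u \<in> X \<Longrightarrow> u \<in> W21"
    and "u \<in> X \<Longrightarrow> (\<And>t. t \<in> {0..1} \<Longrightarrow> u t = v t) \<Longrightarrow> v \<in> X"
    and "u \<in> X \<Longrightarrow> v \<in> X \<Longrightarrow> (\<lambda>t. u t + c * v t) \<in> X"
  using assms unfolding bvp_space_def by blast+

lemma bvp_space_X_D: "bvp_space X_D"
  unfolding bvp_space_def X_D_def using W21_cong W21_add_scaled by auto

lemma bvp_space_X_M2: "bvp_space X_M2"
  unfolding bvp_space_def
proof (intro conjI allI impI ballI)
  show "X_M2 \<subseteq> W21" by (auto simp: X_M2_def)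
  show "v \<in> X_M2" if "u \<in> X_M2" and eq: "\<forall>t\<in>{0..1}. u t = v t" for u v
    using that W21_cong[of u v] D_cong[of u v 1] by (simp add: X_M2_def)
  show "(\<lambda>t. u t + c * v t) \<in> X_M2" if "u \<in> X_M2" "v \<in> X_M2" for u v c
    using that W21_add_scaled[of u v c] D_add_scaled[of u v 1 c] by (simp add: X_M2_def)
qed

lemma bvp_solution_unique:
  assumes X: "bvp_space X" and nr: "nonresonant X a lam"
    and u: "u \<in> X" "L_eq a lam u \<sigma>" and v: "v \<in> X" "L_eq a lam v \<sigma>" and t: "t \<in> {0..1}"
  shows "u t = v t"
proof -
  have "L_eq a lam (\<lambda>t. u t + (- 1) * v t) (\<lambda>t. \<sigma> t + (- 1) * \<sigma> t)"
    by (rule L_eq_add_scaled[OF bvp_spaceD(1)[OF X u(1)] bvp_spaceD(1)[OF X v(1)] u(2) v(2)])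
  then have "L_eq a lam (\<lambda>t. u t + (- 1) * v t) (\<lambda>_. 0)" by simp
  then have "u t + (- 1) * v t = 0"
    using nr bvp_spaceD(3)[OF X u(1) v(1), of "- 1"] t unfolding nonresonant_def by blast
  then show ?thesis by simp
qed

text \<open>
  Nonresonance takes care of uniqueness, so it suffices that the kernel reproduces one solution for
  each right-hand side.
\<close>
lemma is_greenI:
  assumes X: "bvp_space X" and nr: "nonresonant X a lam"
    and G: "continuous_on ({0..1} \<times> {0..1}) G"
    and sol: "\<And>\<sigma>. integrable (lebesgue_on {0..1}) \<sigma> \<Longrightarrow>
      \<exists>v\<in>X. L_eq a lam v \<sigma> \<and>
        (\<forall>t\<in>{0..1}. v t = (LINT s|lebesgue_on {0..1}. G (t, s) * \<sigma> s))"
  shows "is_green X a lam G"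
  unfolding is_green_def Let_def
proof (intro conjI allI impI G)
  fix \<sigma> :: "real \<Rightarrow> real" assume "integrable (lebesgue_on {0..1}) \<sigma>"
  then obtain v where v: "v \<in> X" "L_eq a lam v \<sigma>"
    and eq: "\<And>t. t \<in> {0..1} \<Longrightarrow> v t = (LINT s|lebesgue_on {0..1}. G (t, s) * \<sigma> s)"
    using sol by blast
  let ?w = "\<lambda>t. LINT s|lebesgue_on {0..1}. G (t, s) * \<sigma> s"
  show w: "?w \<in> X" by (rule bvp_spaceD(2)[OF X v(1) eq])
  show Lw: "L_eq a lam ?w \<sigma>" by (rule L_eq_cong[OF v(2) eq]) simp_all
  show "\<forall>u\<in>X. L_eq a lam u \<sigma> \<longrightarrow> (\<forall>t\<in>{0..1}. u t = ?w t)"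
    using bvp_solution_unique[OF X nr _ _ w Lw] by blast
qed

lemma green_eq:
  assumes X: "bvp_space X" and nr: "nonresonant X a lam"
    and G: "is_green X a lam G" and ts: "t \<in> {0..1}" "s \<in> {0..1}"
  shows "green X a lam (t, s) = G (t, s)"
proof -
  let ?Q = "{0..1::real} \<times> {0..1::real}"
  define H where "H = restrict G ?Q"
  have H: "is_green X a lam H"
  proof (rule is_greenI[OF X nr])
    have "continuous_on ?Q G" using G by (simp add: is_green_def)
    then show "continuous_on ?Q H" by (rule continuous_on_eq) (simp add: H_def)
    fix \<sigma> :: "real \<Rightarrow> real" assume \<sigma>: "integrable (lebesgue_on {0..1}) \<sigma>"
    let ?v = "\<lambda>t. LINT s|lebesgue_on {0..1}. G (t, s) * \<sigma> s"
    have "?v \<in> X" "L_eq a lam ?v \<sigma>"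
      using G \<sigma> unfolding is_green_def Let_def by blast+
    moreover have "?v t = (LINT s|lebesgue_on {0..1}. H (t, s) * \<sigma> s)" if "t \<in> {0..1}" for t
      using that by (intro Bochner_Integration.integral_cong) (auto simp: H_def)
    ultimately show "\<exists>v\<in>X. L_eq a lam v \<sigma> \<and>
        (\<forall>t\<in>{0..1}. v t = (LINT s|lebesgue_on {0..1}. H (t, s) * \<sigma> s))"
      by (intro bexI[of _ ?v]) auto
  qed
  have "green X a lam = H"
    unfolding green_def
  proof (rule the_equality)
    show "is_green X a lam H \<and> H \<in> extensional ?Q" using H by (simp add: H_def)
    fix G' assume G': "is_green X a lam G' \<and> G' \<in> extensional ?Q"
    show "G' = H"
    proof (rule extensionalityI)
      show "G' \<in> extensional ?Q" "H \<in> extensional ?Q" using G' by (simp_all add: H_def)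
      show "G' z = H z" if z: "z \<in> ?Q" for z
        using is_green_unique[OF conjunct1[OF G'] H, of "fst z" "snd z"] z by (simp add: mem_Times_iff)
    qed
  qed
  then show ?thesis using ts by (simp add: H_def)
qed

section \<open>The Dirichlet kernel and its correction\<close>

text \<open>
  Two candidates differ by an element of \<open>X_D\<close> that solves the homogeneous equation.
\<close>
lemma r2_eq:
  assumes nr: "nonresonant X_D a lam"
    and v: "v \<in> W21" "L_eq a lam v (\<lambda>_. 0)" "v 0 = 0" "v 1 = 1" and t: "t \<in> {0..1}"
  shows "r2 a lam t = v t"
proof -
  define w where "w = restrict v {0..1}"
  have w: "w \<in> W21" "L_eq a lam w (\<lambda>_. 0)" "w 0 = 0" "w 1 = 1" "w \<in> extensional {0..1}"
    using W21_cong[OF v(1), of w] L_eq_cong[OF v(2), of w "\<lambda>_. 0"] v(3,4) by (simp_all add: w_def)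
  have "r2 a lam = w"
    unfolding r2_def
  proof (rule the_equality)
    show "w \<in> W21 \<and> L_eq a lam w (\<lambda>_. 0) \<and> w 0 = 0 \<and> w 1 = 1 \<and> w \<in> extensional {0..1}"
      using w by simp
    fix u assume u: "u \<in> W21 \<and> L_eq a lam u (\<lambda>_. 0) \<and> u 0 = 0 \<and> u 1 = 1 \<and> u \<in> extensional {0..1}"
    have "L_eq a lam (\<lambda>t. u t + (- 1) * w t) (\<lambda>t. 0 + (- 1) * 0)"
      using u w by (intro L_eq_add_scaled) simp_all
    moreover have "(\<lambda>t. u t + (- 1) * w t) \<in> X_D"
      unfolding X_D_def using W21_add_scaled[of u w "- 1"] u w by simp
    ultimately have "\<forall>t\<in>{0..1}. u t + (- 1) * w t = 0"
      using nr unfolding nonresonant_def by fastforce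
    then show "u = w"
      using u w(5) by (intro extensionalityI[of _ "{0..1}"]) auto
  qed
  then show ?thesis using t by (simp add: w_def)
qed

text \<open>
  The two homogeneous solutions that satisfy one Dirichlet condition each, with a normalisation at \<open>1\<close>
  that makes their Wronskian equal to \<open>1\<close>. They exist because the solution \<open>\<phi>\<close> with \<open>\<phi> 0 = 0\<close>, \<open>\<phi>' 0 = 1\<close>
  cannot vanish at \<open>1\<close>: it would be a nonzero homogeneous solution in \<open>X_D\<close>.
\<close>
lemma fundamental_system_exists:
  assumes a: "integrable (lebesgue_on {0..1}) (\<lambda>t. a t + lam)" and nr: "nonresonant X_D a lam"
  obtains \<rho> \<rho>' \<eta> \<eta>' where
    "integral_solution (\<lambda>t. a t + lam) (\<lambda>_. 0) \<rho> \<rho>'" "\<rho> 0 = 0" "\<rho> 1 = 1"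
    "integral_solution (\<lambda>t. a t + lam) (\<lambda>_. 0) \<eta> \<eta>'" "\<eta> 1 = 0" "\<eta>' 1 = 1"
proof -
  let ?q = "\<lambda>t. a t + lam"
  have z: "integrable (lebesgue_on {0..1::real}) (\<lambda>_. 0 :: real)" by simp
  have comb: "integral_solution ?q (\<lambda>_. 0) (\<lambda>t. u t + c * v t) (\<lambda>t. p t + c * r t)"
    if "integral_solution ?q (\<lambda>_. 0) u p" "integral_solution ?q (\<lambda>_. 0) v r" for u v p r c
    using integral_solution_add_scaled[OF a z z that, of c] by simp
  obtain \<phi> \<phi>' where \<phi>: "integral_solution ?q (\<lambda>_. 0) \<phi> \<phi>'" "\<phi> 0 = 0" "\<phi>' 0 = 1"
    by (rule integral_solution_exists[OF a z])
  have \<phi>1: "\<phi> 1 \<noteq> 0"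
  proof
    assume "\<phi> 1 = 0"
    then have "\<phi> \<in> X_D" using W21_integral_solution[OF a z \<phi>(1)] \<phi>(2) by (simp add: X_D_def)
    then have "\<forall>t\<in>{0..1}. \<phi> t = 0"
      using nr L_eq_integral_solution[OF a z \<phi>(1)] unfolding nonresonant_def by blast
    then have "D \<phi> 0 = D (\<lambda>_. 0) 0" by (intro D_cong) auto
    also have "\<dots> = 0" by (rule D_eqI) auto
    finally show False using D_integral_solution[OF \<phi>(1), of 0] \<phi>(3) by simp
  qed
  obtain \<theta> \<theta>' where \<theta>: "integral_solution ?q (\<lambda>_. 0) \<theta> \<theta>'" "\<theta> 0 = - \<phi> 1" "\<theta>' 0 = 0"
    by (rule integral_solution_exists[OF a z])
  \<comment> \<open>Chosen so that \<open>\<eta> 1 = 0\<close>; since the Wronskian of \<open>\<phi>\<close> and \<open>\<eta>\<close> equals \<open>\<phi> 1\<close> at \<open>0\<close>,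
    where it is \<open>- \<phi>' 0 * \<theta> 0\<close>, comparison with \<open>1\<close> yields \<open>\<eta>' 1 = 1\<close>.\<close>
  define c where "c = - \<theta> 1 / \<phi> 1"
  define \<eta> where "\<eta> t = \<theta> t + c * \<phi> t" for t
  define \<eta>' where "\<eta>' t = \<theta>' t + c * \<phi>' t" for t
  have \<eta>: "integral_solution ?q (\<lambda>_. 0) \<eta> \<eta>'"
    using comb[OF \<theta>(1) \<phi>(1), of c] by (simp add: \<eta>_def[abs_def] \<eta>'_def[abs_def])
  have \<eta>1: "\<eta> 1 = 0" using \<phi>1 by (simp add: \<eta>_def c_def)
  have "\<phi> 1 * \<eta>' 1 - \<phi>' 1 * \<eta> 1 = \<phi> 0 * \<eta>' 0 - \<phi>' 0 * \<eta> 0 + integral {0..1} (\<lambda>s. \<phi> s * 0)"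
    by (rule lagrange_identity[OF a z \<eta> \<phi>(1)]) simp
  then have \<eta>'1: "\<eta>' 1 = 1"
    using \<phi>1 \<phi>(2,3) \<theta>(2) \<eta>1 by (simp add: \<eta>_def)
  \<comment> \<open>\<open>\<phi> + d * \<phi>\<close> is \<open>\<phi> / \<phi> 1\<close>.\<close>
  define d where "d = 1 / \<phi> 1 - 1"
  have \<rho>: "integral_solution ?q (\<lambda>_. 0) (\<lambda>t. \<phi> t + d * \<phi> t) (\<lambda>t. \<phi>' t + d * \<phi>' t)"
    by (rule comb[OF \<phi>(1) \<phi>(1)])
  show thesis
    by (rule that[OF \<rho> _ _ \<eta> \<eta>1 \<eta>'1]) (use \<phi>(2) \<phi>1 in \<open>simp_all add: d_def field_simps\<close>)
qed

definition green_kernel :: "(real \<Rightarrow> real) \<Rightarrow> (real \<Rightarrow> real) \<Rightarrow> real \<times> real \<Rightarrow> real" where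
  "green_kernel \<rho> \<eta> z = \<rho> (min (fst z) (snd z)) * \<eta> (max (fst z) (snd z))"

lemma green_kernel_commute: "green_kernel \<rho> \<eta> (t, s) = green_kernel \<rho> \<eta> (s, t)"
  by (simp add: green_kernel_def min.commute max.commute)

lemma continuous_on_green_kernel:
  assumes "continuous_on {0..1} \<rho>" "continuous_on {0..1} \<eta>"
  shows "continuous_on ({0..1} \<times> {0..1}) (green_kernel \<rho> \<eta>)"
  unfolding green_kernel_def[abs_def]
  by (intro continuous_on_mult continuous_on_compose2[OF assms(1)] continuous_on_compose2[OF assms(2)]
      continuous_intros) auto

text \<open>
  For \<open>t\<close> near \<open>1\<close> the kernel is \<open>\<rho> s * \<eta> t\<close>. As the kernel is symmetric, this serves for the
  derivatives in both variables.
\<close>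
lemma D_green_kernel_at_1:
  assumes \<eta>: "(\<eta> has_real_derivative d) (at 1 within {0..1})" and s: "0 < s" "s < 1"
    and f: "\<And>t. t \<in> {0..1} \<Longrightarrow> f t = green_kernel \<rho> \<eta> (t, s)"
  shows "D f 1 = \<rho> s * d"
proof (rule D_eqI)
  have "((\<lambda>t. \<rho> s * \<eta> t) has_real_derivative \<rho> s * d) (at 1 within {0..1})"
    by (rule DERIV_cmult[OF \<eta>])
  then show "(f has_real_derivative \<rho> s * d) (at 1 within {0..1})"
  proof (rule has_field_derivative_transform_within[of _ _ _ _ "1 - s"])
    fix t :: real assume "t \<in> {0..1}" "dist t 1 < 1 - s"
    then show "\<rho> s * \<eta> t = f t"
      using f[of t] by (auto simp: green_kernel_def dist_real_def min_def max_def)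
  qed (use s in auto)
qed simp

text \<open>
  Variation of constants read backwards. The Lagrange identity for \<open>\<rho>\<close> on \<open>[0, t]\<close> and for \<open>\<eta>\<close> on \<open>[t, 1]\<close>
  expresses the two partial integrals by \<open>v\<close> and \<open>p\<close> at \<open>t\<close>; in the combination \<open>\<eta> t\<close> times the first
  plus \<open>\<rho> t\<close> times the second, \<open>p t\<close> cancels and \<open>v t\<close> is multiplied by the Wronskian, which is \<open>1\<close>.
\<close>
lemma green_kernel_representation:
  assumes q: "integrable (lebesgue_on {0..1}) q" and \<sigma>: "integrable (lebesgue_on {0..1}) \<sigma>"
    and \<rho>: "integral_solution q (\<lambda>_. 0) \<rho> \<rho>'" "\<rho> 0 = 0" "\<rho> 1 = 1"
    and \<eta>: "integral_solution q (\<lambda>_. 0) \<eta> \<eta>'" "\<eta> 1 = 0" "\<eta>' 1 = 1"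
    and v: "integral_solution q \<sigma> v p" "v 0 = 0" "v 1 = 0"
    and t: "t \<in> {0..1}"
  shows "(LINT s|lebesgue_on {0..1}. green_kernel \<rho> \<eta> (t, s) * \<sigma> s) = v t"
proof -
  let ?M = "lebesgue_on {0..1::real}"
  have z: "integrable ?M (\<lambda>_. 0 :: real)" by simp
  have W: "\<rho> x * \<eta>' x - \<rho>' x * \<eta> x = 1" if "x \<in> {0..1}" for x
    using lagrange_identity[OF q z \<eta>(1) \<rho>(1) that] lagrange_identity[OF q z \<eta>(1) \<rho>(1), of 1]
      \<rho>(3) \<eta>(2,3) by simp
  have L\<rho>: "\<rho> t * p t - \<rho>' t * v t = integral {0..t} (\<lambda>s. \<rho> s * \<sigma> s)"
    using lagrange_identity[OF q \<sigma> v(1) \<rho>(1) t] \<rho>(2) v(2) by simp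
  have i\<eta>: "integrable ?M (\<lambda>s. \<eta> s * \<sigma> s)" and i\<rho>: "integrable ?M (\<lambda>s. \<rho> s * \<sigma> s)"
    using integrable_mult_continuous[OF \<sigma> integral_solutionD(1)[OF \<eta>(1)]]
      integrable_mult_continuous[OF \<sigma> integral_solutionD(1)[OF \<rho>(1)]] by (simp_all add: mult.commute)
  have L\<eta>: "- (\<eta> t * p t - \<eta>' t * v t) = integral {t..1} (\<lambda>s. \<eta> s * \<sigma> s)"
    using lagrange_identity[OF q \<sigma> v(1) \<eta>(1) t] lagrange_identity[OF q \<sigma> v(1) \<eta>(1), of 1]
      \<eta>(2) v(3) integral_diff_subinterval[OF i\<eta>, of t 1] t by simp
  have "continuous_on {0..1} (\<lambda>s. green_kernel \<rho> \<eta> (t, s))"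
    by (rule continuous_on_compose2[OF continuous_on_green_kernel[OF integral_solutionD(1)[OF \<rho>(1)]
            integral_solutionD(1)[OF \<eta>(1)]], of _ "\<lambda>s. (t, s)"])
      (use t in \<open>auto intro!: continuous_intros\<close>)
  from integrable_mult_continuous[OF \<sigma> this]
  have iG: "integrable ?M (\<lambda>s. green_kernel \<rho> \<eta> (t, s) * \<sigma> s)" by (simp add: mult.commute)
  have "(LINT s|?M. green_kernel \<rho> \<eta> (t, s) * \<sigma> s) = integral {0..1} (\<lambda>s. green_kernel \<rho> \<eta> (t, s) * \<sigma> s)"
    using iG by (simp add: lebesgue_integral_eq_integral)
  also have "\<dots> = integral {0..t} (\<lambda>s. green_kernel \<rho> \<eta> (t, s) * \<sigma> s)
      + integral {t..1} (\<lambda>s. green_kernel \<rho> \<eta> (t, s) * \<sigma> s)"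
    using integral_diff_subinterval[OF iG, of t 1] t by simp
  also have "integral {0..t} (\<lambda>s. green_kernel \<rho> \<eta> (t, s) * \<sigma> s) = integral {0..t} (\<lambda>s. \<eta> t * (\<rho> s * \<sigma> s))"
    by (intro integral_cong) (auto simp: green_kernel_def min_def max_def)
  also have "\<dots> = \<eta> t * integral {0..t} (\<lambda>s. \<rho> s * \<sigma> s)" by (rule integral_mult_right)
  also have "integral {t..1} (\<lambda>s. green_kernel \<rho> \<eta> (t, s) * \<sigma> s) = integral {t..1} (\<lambda>s. \<rho> t * (\<eta> s * \<sigma> s))"
    by (intro integral_cong) (auto simp: green_kernel_def min_def max_def)
  also have "\<dots> = \<rho> t * integral {t..1} (\<lambda>s. \<eta> s * \<sigma> s)" by (rule integral_mult_right)
  also have "\<eta> t * integral {0..t} (\<lambda>s. \<rho> s * \<sigma> s) + \<rho> t * integral {t..1} (\<lambda>s. \<eta> s * \<sigma> s)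
      = (\<rho> t * \<eta>' t - \<rho>' t * \<eta> t) * v t"
    unfolding L\<rho>[symmetric] L\<eta>[symmetric] by (simp add: algebra_simps)
  finally show ?thesis using W[OF t] by simp
qed

text \<open>
  Shooting: subtract from any solution that starts at \<open>0\<close> the multiple of \<open>\<rho>\<close> with the same value
  at \<open>1\<close>.
\<close>
lemma dirichlet_solution_exists:
  assumes q: "integrable (lebesgue_on {0..1}) q" and \<sigma>: "integrable (lebesgue_on {0..1}) \<sigma>"
    and \<rho>: "integral_solution q (\<lambda>_. 0) \<rho> \<rho>'" "\<rho> 0 = 0" "\<rho> 1 = 1"
  obtains v p where "integral_solution q \<sigma> v p" "v 0 = 0" "v 1 = 0"
proof -
  obtain u r where u: "integral_solution q \<sigma> u r" "u 0 = 0" "r 0 = 0"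
    by (rule integral_solution_exists[OF q \<sigma>])
  have "integrable (lebesgue_on {0..1::real}) (\<lambda>_. 0 :: real)" by simp
  from integral_solution_add_scaled[OF q \<sigma> this u(1) \<rho>(1), of "- u 1"]
  have "integral_solution q \<sigma> (\<lambda>t. u t + (- u 1) * \<rho> t) (\<lambda>t. r t + (- u 1) * \<rho>' t)" by simp
  then show thesis by (rule that) (use u(2) \<rho> in simp_all)
qed

theorem theorem4p1:
  fixes a :: "real \<Rightarrow> real" and lam :: real
  assumes "integrable (lebesgue_on {0..1}) a"
    and "nonresonant X_D a lam"
    and "D (r2 a lam) 1 \<noteq> 0"
  shows "nonresonant X_M2 a lam \<and> dsdt_at_11 (green X_D a lam) \<noteq> 0 \<and>
    (\<forall>t\<in>{0..1}. \<forall>s\<in>{0..1}.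
       green X_M2 a lam (t, s) =
         green X_D a lam (t, s)
           - r2 a lam t / D (r2 a lam) 1 * dt_at_1 (green X_D a lam) s \<and>
       green X_D a lam (t, s)
           - r2 a lam t / D (r2 a lam) 1 * dt_at_1 (green X_D a lam) s =
         green X_D a lam (t, s)
           - ds_at_1 (green X_D a lam) t / dsdt_at_11 (green X_D a lam)
             * dt_at_1 (green X_D a lam) s)"
proof -
  let ?q = "\<lambda>t. a t + lam" and ?M = "lebesgue_on {0..1::real}"
  note nr = assms(2)
  have q: "integrable ?M ?q"
    by (rule Bochner_Integration.integrable_add[OF assms(1) continuous_imp_integrable_real]) simp
  have z: "integrable ?M (\<lambda>_. 0 :: real)" by simp
  obtain \<rho> \<rho>' \<eta> \<eta>' where
    \<rho>: "integral_solution ?q (\<lambda>_. 0) \<rho> \<rho>'" "\<rho> 0 = 0" "\<rho> 1 = 1" and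
    \<eta>: "integral_solution ?q (\<lambda>_. 0) \<eta> \<eta>'" "\<eta> 1 = 0" "\<eta>' 1 = 1"
    by (rule fundamental_system_exists[OF q nr])
  have \<rho>W: "\<rho> \<in> W21" by (rule W21_integral_solution[OF q z \<rho>(1)])
  have \<rho>L: "L_eq a lam \<rho> (\<lambda>_. 0)" by (rule L_eq_integral_solution[OF q z \<rho>(1)])
  have \<rho>c: "continuous_on {0..1} \<rho>" and \<eta>c: "continuous_on {0..1} \<eta>"
    using integral_solutionD(1) \<rho>(1) \<eta>(1) by blast+
  have r2: "r2 a lam t = \<rho> t" if "t \<in> {0..1}" for t
    by (rule r2_eq[OF nr \<rho>W \<rho>L \<rho>(2,3) that])
  have Dr2: "D (r2 a lam) 1 = \<rho>' 1"
    using D_cong[of "r2 a lam" \<rho> 1] r2 D_integral_solution[OF \<rho>(1), of 1] by simp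
  then have \<rho>'1: "\<rho>' 1 \<noteq> 0" using assms(3) by simp

  let ?k = "green_kernel \<rho> \<eta>"
  have kc: "continuous_on ({0..1} \<times> {0..1}) ?k" by (rule continuous_on_green_kernel[OF \<rho>c \<eta>c])
  have "is_green X_D a lam ?k"
  proof (rule is_greenI[OF bvp_space_X_D nr kc])
    fix \<sigma> :: "real \<Rightarrow> real" assume \<sigma>: "integrable ?M \<sigma>"
    obtain v p where v: "integral_solution ?q \<sigma> v p" "v 0 = 0" "v 1 = 0"
      by (rule dirichlet_solution_exists[OF q \<sigma> \<rho>])
    show "\<exists>v\<in>X_D. L_eq a lam v \<sigma> \<and> (\<forall>t\<in>{0..1}. v t = (LINT s|?M. ?k (t, s) * \<sigma> s))"
    proof (intro bexI[of _ v] conjI ballI)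
      show "v \<in> X_D" using W21_integral_solution[OF q \<sigma> v(1)] v(2,3) by (simp add: X_D_def)
      show "L_eq a lam v \<sigma>" by (rule L_eq_integral_solution[OF q \<sigma> v(1)])
      show "v t = (LINT s|?M. ?k (t, s) * \<sigma> s)" if "t \<in> {0..1}" for t
        by (rule green_kernel_representation[OF q \<sigma> \<rho> \<eta> v that, symmetric])
    qed
  qed
  then have GD: "green X_D a lam (t, s) = ?k (t, s)" if "t \<in> {0..1}" "s \<in> {0..1}" for t s
    using green_eq[OF bvp_space_X_D nr] that by blast

  have \<eta>d: "(\<eta> has_real_derivative 1) (at 1 within {0..1})"
    using integral_solution_has_derivative[OF \<eta>(1), of 1] \<eta>(3) by simp
  have dt: "dt_at_1 (green X_D a lam) s = \<rho> s" if s: "s \<in> {0..1}" for s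
    unfolding dt_at_1_def
  proof (rule ext01_eq[OF \<rho>c _ s])
    fix s :: real assume s: "s \<in> {0<..<1}"
    have "D (\<lambda>t. green X_D a lam (t, s)) 1 = \<rho> s * 1"
      by (rule D_green_kernel_at_1[OF \<eta>d]) (use s GD in auto)
    then show "D (\<lambda>t. green X_D a lam (t, s)) 1 = \<rho> s" by simp
  qed
  have ds: "ds_at_1 (green X_D a lam) t = \<rho> t" if t: "t \<in> {0..1}" for t
    unfolding ds_at_1_def
  proof (rule ext01_eq[OF \<rho>c _ t])
    fix t :: real assume t: "t \<in> {0<..<1}"
    have "D (\<lambda>s. green X_D a lam (t, s)) 1 = \<rho> t * 1"
      by (rule D_green_kernel_at_1[OF \<eta>d]) (use t GD green_kernel_commute in auto)
    then show "D (\<lambda>s. green X_D a lam (t, s)) 1 = \<rho> t" by simp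
  qed
  have dsdt: "dsdt_at_11 (green X_D a lam) = \<rho>' 1"
    unfolding dsdt_at_11_def
    using D_cong[of "ds_at_1 (green X_D a lam)" \<rho> 1] ds D_integral_solution[OF \<rho>(1), of 1] by simp

  have nrM: "nonresonant X_M2 a lam"
    unfolding nonresonant_def
  proof (intro ballI impI)
    fix u t assume u: "u \<in> X_M2" "L_eq a lam u (\<lambda>_. 0)" and t: "t \<in> {0..1::real}"
    have uW: "u \<in> W21" using u(1) by (simp add: X_M2_def)
    \<comment> \<open>Every homogeneous solution that vanishes at \<open>0\<close> is a multiple of \<open>\<rho>\<close>; as \<open>\<rho>' 1 \<noteq> 0\<close>, only the zero
      multiple lies in \<open>X_M2\<close>.\<close>
    let ?w = "\<lambda>t. u t + (- u 1) * \<rho> t"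
    have "?w \<in> X_D"
      using W21_add_scaled[OF uW \<rho>W, of "- u 1"] u(1) \<rho>(2,3) by (simp add: X_D_def X_M2_def)
    moreover have "L_eq a lam ?w (\<lambda>_. 0)"
      using L_eq_add_scaled[OF uW \<rho>W u(2) \<rho>L, of "- u 1"] by simp
    ultimately have w0: "?w t = 0" if "t \<in> {0..1}" for t
      using nr that unfolding nonresonant_def by blast
    have "D ?w 1 = D (\<lambda>_. 0) 1" by (rule D_cong[OF w0]) simp_all
    also have "\<dots> = 0" by (rule D_eqI) auto
    finally have "D u 1 + (- u 1) * D \<rho> 1 = 0" using D_add_scaled[OF uW \<rho>W, of 1 "- u 1"] by simp
    then have "u 1 = 0"
      using u(1) \<rho>'1 D_integral_solution[OF \<rho>(1), of 1] by (simp add: X_M2_def)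
    then show "u t = 0" using w0[OF t] by simp
  qed

  let ?m = "\<lambda>z. ?k z - \<rho> (fst z) / \<rho>' 1 * \<rho> (snd z)"
  have "is_green X_M2 a lam ?m"
  proof (rule is_greenI[OF bvp_space_X_M2 nrM])
    show "continuous_on ({0..1} \<times> {0..1}) ?m"
      by (intro continuous_intros kc continuous_on_compose2[OF \<rho>c] \<rho>'1) (auto simp: \<rho>'1)
    fix \<sigma> :: "real \<Rightarrow> real" assume \<sigma>: "integrable ?M \<sigma>"
    obtain v p where v: "integral_solution ?q \<sigma> v p" "v 0 = 0" "v 1 = 0"
      by (rule dirichlet_solution_exists[OF q \<sigma> \<rho>])
    have vW: "v \<in> W21" by (rule W21_integral_solution[OF q \<sigma> v(1)])
    have i\<rho>: "integrable ?M (\<lambda>s. \<rho> s * \<sigma> s)"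
      using integrable_mult_continuous[OF \<sigma> \<rho>c] by (simp add: mult.commute)
    \<comment> \<open>The Lagrange identity on all of \<open>[0, 1]\<close>: subtracting \<open>p 1 / \<rho>' 1\<close> times \<open>\<rho>\<close> from \<open>v\<close> removes the
      derivative at \<open>1\<close>, and \<open>p 1\<close> is itself an integral of \<open>\<sigma>\<close>, which gives the correction of the kernel.\<close>
    have p1: "p 1 = (LINT s|?M. \<rho> s * \<sigma> s)"
      using lagrange_identity[OF q \<sigma> v(1) \<rho>(1), of 1] v(2,3) \<rho>(2,3) i\<rho>
      by (simp add: lebesgue_integral_eq_integral)
    let ?w = "\<lambda>t. v t + (- p 1 / \<rho>' 1) * \<rho> t"
    show "\<exists>v\<in>X_M2. L_eq a lam v \<sigma> \<and> (\<forall>t\<in>{0..1}. v t = (LINT s|?M. ?m (t, s) * \<sigma> s))"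
    proof (intro bexI[of _ ?w] conjI ballI)
      have "D ?w 1 = D v 1 + (- p 1 / \<rho>' 1) * D \<rho> 1" by (rule D_add_scaled[OF vW \<rho>W]) simp
      also have "\<dots> = 0"
        using \<rho>'1 D_integral_solution[OF \<rho>(1), of 1] D_integral_solution[OF v(1), of 1] by simp
      finally show "?w \<in> X_M2"
        using W21_add_scaled[OF vW \<rho>W, of "- p 1 / \<rho>' 1"] v(2) \<rho>(2) by (simp add: X_M2_def)
      show "L_eq a lam ?w \<sigma>"
        using L_eq_add_scaled[OF vW \<rho>W L_eq_integral_solution[OF q \<sigma> v(1)] \<rho>L, of "- p 1 / \<rho>' 1"] by simp
      fix t :: real assume t: "t \<in> {0..1}"
      have "continuous_on {0..1} (\<lambda>s. ?k (t, s))"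
        by (rule continuous_on_compose2[OF kc, of _ "\<lambda>s. (t, s)"]) (use t in \<open>auto intro!: continuous_intros\<close>)
      from integrable_mult_continuous[OF \<sigma> this]
      have ik: "integrable ?M (\<lambda>s. ?k (t, s) * \<sigma> s)" by (simp add: mult.commute)
      have "(LINT s|?M. ?m (t, s) * \<sigma> s) = (LINT s|?M. ?k (t, s) * \<sigma> s - \<rho> t / \<rho>' 1 * (\<rho> s * \<sigma> s))"
        by (simp add: left_diff_distrib mult.assoc)
      also have "\<dots> = (LINT s|?M. ?k (t, s) * \<sigma> s) - \<rho> t / \<rho>' 1 * p 1"
        using ik i\<rho> by (simp add: p1)
      finally show "?w t = (LINT s|?M. ?m (t, s) * \<sigma> s)"
        using green_kernel_representation[OF q \<sigma> \<rho> \<eta> v t] by simp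
    qed
  qed
  then have GM: "green X_M2 a lam (t, s) = ?k (t, s) - \<rho> t / \<rho>' 1 * \<rho> s"
    if "t \<in> {0..1}" "s \<in> {0..1}" for t s
    using green_eq[OF bvp_space_X_M2 nrM _ that] by simp
  show ?thesis
    using nrM \<rho>'1 by (simp add: dsdt GM GD r2 Dr2 dt ds del: atLeastAtMost_iff)
qed

end
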